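(* Let $\varepsilon\in\{1,-1\}$. For any $t\in\mathbb{R}$, $$\Phi_{\varepsilon}(t)=\cos t\; R+\sin t\; Q_{\varepsilon}$$ defines a left invariant integrable $(1,-1)$-structure on $(\mathcal{E},g)$, where $(\mathcal{E},g)$ is the Riemannian manifold of ellipses of area $\pi$ in the plane, identified with the Lie group $G=T_1\ltimes\mathbb{R}^2$ with its left invariant metric, and $R$, $Q_\varepsilon$ are the integrable $(1,-1)$-structures described in the context.
   Context: The manifold. $\mathcal{E}$ is the set of all ellipses $E(A,a)=\{z\in\mathbb{R}^2 : (z-a)^tA^{-1}(z-a)=1\}$ with $a\in\mathbb{R}^2$ and $A$ a positive definite $2\times2$ matrix with $\det A=1$. The group $H=SL_2(\mathbb{R})\ltimes\mathbb{R}^2$ acts transitively on $\mathcal{E}$ with isotropy subgroup $K=SO_2\times\{0\}$ at $E(I,0)$, so $\mathcal{E}=H/K$. $H$ carries the left invariant metric given at the identity by $\mathrm{tr}(X^tY)+x^ty$ on $(X,x),(Y,y)$, and $g$ on $\mathcal{E}$ is the $H$-invariant Riemannian metric making $H\to\mathcal{E}$ a Riemannian submersion. $(\mathcal{E},g)$ is isometric to, and is identified with, the Lie group $G=T_1\ltimes\mathbb{R}^2$ ($T_1$ the group of upper triangular $2\times 2$ matrices of determinant $1$) with the left invariant Riemannian metric $g$ for which the following basis of its Lie algebra $\mathfrak{g}$ is orthonormal: $e_1=(0,(1,0))$, $e_2=(0,(0,1))$, $e_3=\left(\begin{pmatrix}1&0\\0&-1\end{pmatrix},0\right)$, $e_4=\left(\begin{pmatrix}0&2\\0&0\end{pmatrix},0\right)$.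 The brackets are $[e_1,e_2]=[e_1,e_4]=0$, $[e_3,e_4]=2e_4$, $[e_4,e_2]=2e_1$, $[e_3,e_1]=e_1$, $[e_2,e_3]=e_2$. The structures. Let $r$ be the left invariant $(1,1)$-tensor on $G$ equal to $\mathrm{id}$ on $\mathrm{span}\{e_1,e_2\}$ and $-\mathrm{id}$ on $\mathrm{span}\{e_3,e_4\}$. Let $J_\varepsilon$ be the left invariant almost complex structure with $J_\varepsilon e_1=e_2$, $J_\varepsilon e_3=\varepsilon e_4$, and $\omega_\varepsilon(x,y)=g(J_\varepsilon x,y)$ (a symplectic form). In block form with respect to $\mathbb{T}G=TG\oplus TG^{*}$, $$R=\begin{pmatrix} r&0\\0&-r^{*}\end{pmatrix},\qquad Q_\varepsilon=\begin{pmatrix}0&(\omega_\varepsilon^{\flat})^{-1}\\ \omega_\varepsilon^{\flat}&0\end{pmatrix},$$ where $c^{\flat}(u)(v)=c(u,v)$ for a bilinear form $c$, and $r^*$ is the dual map of $r$. Integrable $(1,-1)$-structures. On a manifold $M$, $\mathbb{T}M=TM\oplus TM^{*}$ carries $b(u+\sigma,v+\tau)=\tau(u)+\sigma(v)$ and the Courant bracket $[u+\sigma,v+\tau]=[u,v]+\mathcal{L}_u\tau-\mathcal{L}_v\sigma-\tfrac12 d(\tau(u)-\sigma(v))$. A generalized paracomplex structure is a smooth section $S$ of $\mathrm{End}(\mathbb{T}M)$ with $S^2=\mathrm{id}$, $\operatorname{tr}S=0$, $S$ skew-symmetric for $b$, and such that the sections of each $\pm1$-eigenbundle are closed under the Courant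 bracket. An integrable $(1,-1)$-structure on a pseudo Riemannian manifold $(M,g)$ is a generalized paracomplex structure $S$ with $SI_1=-I_1S$, where $I_1=\begin{pmatrix}0&(g^{\flat})^{-1}\\ g^{\flat}&0\end{pmatrix}$. *)

theory Defs
  imports "HOL-Analysis.Analysis"
begin

section \<open>Calculus on an open subset of a Euclidean space\<close>

text \<open>On an open \<open>U\<close>: \<open>C^0\<close> is continuity, and \<open>C^(k+1)\<close> is
  differentiability together with all directional derivatives being \<open>C^k\<close>.\<close>

primrec Ck_on ::
    "nat \<Rightarrow> 'a::real_normed_vector set \<Rightarrow> ('a \<Rightarrow> 'b::real_normed_vector) \<Rightarrow> bool" where
  "Ck_on 0 U f \<longleftrightarrow> continuous_on U f"
| "Ck_on (Suc k) U f \<longleftrightarrow>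
     f differentiable_on U \<and> (\<forall>v. Ck_on k U (\<lambda>p. frechet_derivative f (at p) v))"

definition smooth_on ::
    "'a::real_normed_vector set \<Rightarrow> ('a \<Rightarrow> 'b::real_normed_vector) \<Rightarrow> bool" where
  "smooth_on U f \<longleftrightarrow> (\<forall>k. Ck_on k U f)"

definition fderiv ::
    "('a::real_normed_vector \<Rightarrow> 'b::real_normed_vector) \<Rightarrow> 'a \<Rightarrow> 'a \<Rightarrow>\<^sub>L 'b" where
  "fderiv f p = Blinfun (frechet_derivative f (at p))"

definition lie_bracket ::
    "('a::euclidean_space \<Rightarrow> 'a) \<Rightarrow> ('a \<Rightarrow> 'a) \<Rightarrow> 'a \<Rightarrow> 'a" where
  "lie_bracket u v p = fderiv v p (u p) - fderiv u p (v p)"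

text \<open>Lie derivative of a one-form; in coordinates
  \<open>(L_u \<tau>)_j = u^i \<partial>_i \<tau>_j + \<tau>_i \<partial>_j u^i\<close>.\<close>

definition lie_deriv ::
    "('a::euclidean_space \<Rightarrow> 'a) \<Rightarrow> ('a \<Rightarrow> 'a \<Rightarrow>\<^sub>L real) \<Rightarrow> 'a \<Rightarrow> 'a \<Rightarrow>\<^sub>L real" where
  "lie_deriv u \<tau> p = fderiv \<tau> p (u p) + (\<tau> p o\<^sub>L fderiv u p)"


section \<open>The generalized tangent bundle\<close>

text \<open>The fibre \<open>T_pM \<oplus> T_pM*\<close> in a chart with values in \<open>'a\<close>.\<close>

type_synonym 'a gtan = "'a \<times> ('a \<Rightarrow>\<^sub>L real)"

definition pairing :: "'a::euclidean_space gtan \<Rightarrow> 'a gtan \<Rightarrow> real" where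
  "pairing w z = snd z (fst w) + snd w (fst z)"

text \<open>For a function \<open>f\<close>, the one-form \<open>df\<close> is \<open>fderiv f\<close>.\<close>

definition courant ::
    "('a::euclidean_space \<Rightarrow> 'a gtan) \<Rightarrow> ('a \<Rightarrow> 'a gtan) \<Rightarrow> 'a \<Rightarrow> 'a gtan" where
  "courant w z p =
     (let u = (\<lambda>q. fst (w q)); \<sigma> = (\<lambda>q. snd (w q));
          v = (\<lambda>q. fst (z q)); \<tau> = (\<lambda>q. snd (z q))
      in (lie_bracket u v p,
          lie_deriv u \<tau> p - lie_deriv v \<sigma> p
            - (1/2) *\<^sub>R fderiv (\<lambda>q. \<tau> q (u q) - \<sigma> q (v q)) p))"

text \<open>Trace of an endomorphism of a fibre, computed in the basis of \<open>'a \<oplus> 'a*\<close>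
  consisting of \<open>Basis\<close> and its dual basis.\<close>

definition gtrace :: "('a::euclidean_space gtan \<Rightarrow>\<^sub>L 'a gtan) \<Rightarrow> real" where
  "gtrace S = (\<Sum>i\<in>Basis. fst (S (i, 0)) \<bullet> i)
            + (\<Sum>i\<in>Basis. snd (S (0, blinfun_inner_left i)) i)"

definition eigensection ::
    "'a::euclidean_space set \<Rightarrow> ('a \<Rightarrow> 'a gtan \<Rightarrow>\<^sub>L 'a gtan) \<Rightarrow> real \<Rightarrow> ('a \<Rightarrow> 'a gtan) \<Rightarrow> bool" where
  "eigensection U S l w \<longleftrightarrow> smooth_on U w \<and> (\<forall>p\<in>U. S p (w p) = l *\<^sub>R w p)"

text \<open>The Courant bracket of smooth sections is smooth, so that closure of the sections
  of an eigenbundle is a pointwise condition on brackets.\<close>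

definition gen_paracomplex_on ::
    "'a::euclidean_space set \<Rightarrow> ('a \<Rightarrow> 'a gtan \<Rightarrow>\<^sub>L 'a gtan) \<Rightarrow> bool" where
  "gen_paracomplex_on U S \<longleftrightarrow>
     smooth_on U S \<and>
     (\<forall>p\<in>U. S p o\<^sub>L S p = id_blinfun) \<and>
     (\<forall>p\<in>U. gtrace (S p) = 0) \<and>
     (\<forall>p\<in>U. \<forall>w z. pairing (S p w) z = - pairing w (S p z)) \<and>
     (\<forall>l\<in>{1, -1}. \<forall>w z. eigensection U S l w \<longrightarrow> eigensection U S l z \<longrightarrow>
        (\<forall>p\<in>U. S p (courant w z p) = l *\<^sub>R courant w z p))"

text \<open>A bilinear form \<open>c\<close> is an element of \<open>'a \<Rightarrow>\<^sub>L 'a \<Rightarrow>\<^sub>L real\<close>, so that as a map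
  it is its own \<open>flat\<close>: \<open>c u v = c(u, v)\<close>.\<close>

definition pseudo_riemannian_on ::
    "'a::euclidean_space set \<Rightarrow> ('a \<Rightarrow> 'a \<Rightarrow>\<^sub>L 'a \<Rightarrow>\<^sub>L real) \<Rightarrow> bool" where
  "pseudo_riemannian_on U g \<longleftrightarrow>
     smooth_on U g \<and>
     (\<forall>p\<in>U. \<forall>u v. g p u v = g p v u) \<and>
     (\<forall>p\<in>U. \<forall>u. (\<forall>v. g p u v = 0) \<longrightarrow> u = 0)"

text \<open>The block matrix with zero diagonal blocks, upper right block the inverse of
  \<open>c\<close> and lower left block \<open>c\<close>; used for nondegenerate \<open>c\<close>.\<close>

definition antidiag :: "('a::euclidean_space \<Rightarrow>\<^sub>L 'a \<Rightarrow>\<^sub>L real) \<Rightarrow> 'a gtan \<Rightarrow>\<^sub>L 'a gtan" where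
  "antidiag c = Blinfun (\<lambda>w. (inv (blinfun_apply c) (snd w), c (fst w)))"

definition one_minus_one_structure_on ::
    "'a::euclidean_space set \<Rightarrow> ('a \<Rightarrow> 'a \<Rightarrow>\<^sub>L 'a \<Rightarrow>\<^sub>L real) \<Rightarrow>
     ('a \<Rightarrow> 'a gtan \<Rightarrow>\<^sub>L 'a gtan) \<Rightarrow> bool" where
  "one_minus_one_structure_on U g S \<longleftrightarrow>
     pseudo_riemannian_on U g \<and>
     gen_paracomplex_on U S \<and>
     (\<forall>p\<in>U. S p o\<^sub>L antidiag (g p) = - (antidiag (g p) o\<^sub>L S p))"


section \<open>Manifolds with a global chart\<close>

text \<open>A manifold is given by its set \<open>M\<close> of points and a global chart \<open>\<kappa>\<close>. Tensor
  fields are functions of the point, with values expressed in the chart.\<close>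

definition global_chart :: "'m set \<Rightarrow> ('m \<Rightarrow> 'a::euclidean_space) \<Rightarrow> bool" where
  "global_chart M \<kappa> \<longleftrightarrow> inj_on \<kappa> M \<and> open (\<kappa> ` M)"

definition chart_diff ::
    "'m set \<Rightarrow> ('m \<Rightarrow> 'a::euclidean_space) \<Rightarrow> ('m \<Rightarrow> 'm) \<Rightarrow> 'm \<Rightarrow> 'a \<Rightarrow>\<^sub>L 'a" where
  "chart_diff M \<kappa> f p = fderiv (\<kappa> \<circ> f \<circ> inv_into M \<kappa>) (\<kappa> p)"

definition integrable_one_minus_one_structure ::
    "'m set \<Rightarrow> ('m \<Rightarrow> 'a::euclidean_space) \<Rightarrow> ('m \<Rightarrow> 'a \<Rightarrow>\<^sub>L 'a \<Rightarrow>\<^sub>L real) \<Rightarrow>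
     ('m \<Rightarrow> 'a gtan \<Rightarrow>\<^sub>L 'a gtan) \<Rightarrow> bool" where
  "integrable_one_minus_one_structure M \<kappa> g S \<longleftrightarrow>
     global_chart M \<kappa> \<and>
     one_minus_one_structure_on (\<kappa> ` M) (g \<circ> inv_into M \<kappa>) (S \<circ> inv_into M \<kappa>)"

text \<open>The map \<open>df \<oplus> (df*)^{-1}\<close> induced on \<open>TM \<oplus> TM*\<close> by a diffeomorphism with
  differential \<open>A\<close>.\<close>

definition gtan_map :: "('a::euclidean_space \<Rightarrow>\<^sub>L 'a) \<Rightarrow> 'a gtan \<Rightarrow> 'a gtan" where
  "gtan_map A w = (A (fst w), Blinfun (\<lambda>v. snd w (inv (blinfun_apply A) v)))"


section \<open>The manifold of ellipses and the group acting simply transitively on it\<close>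

definition positive_definite :: "real^2^2 \<Rightarrow> bool" where
  "positive_definite A \<longleftrightarrow> transpose A = A \<and> (\<forall>z. z \<noteq> 0 \<longrightarrow> 0 < z \<bullet> (A *v z))"

definition ellipse :: "real^2^2 \<Rightarrow> real^2 \<Rightarrow> (real^2) set" where
  "ellipse A a = {z. (z - a) \<bullet> (matrix_inv A *v (z - a)) = 1}"

definition ellipses :: "(real^2) set set" where
  "ellipses = {ellipse A a | A a. positive_definite A \<and> det A = 1}"

text \<open>\<open>(X, x)\<close> stands for the affine map \<open>z \<mapsto> X z + x\<close>, and also for an element
  of the Lie algebra of the affine group.\<close>

type_synonym aff = "(real^2^2) \<times> (real^2)"

definition aff_mult :: "aff \<Rightarrow> aff \<Rightarrow> aff" where
  "aff_mult h k = (fst h ** fst k, fst h *v snd k + snd h)"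

text \<open>The upper triangular matrices in \<open>T1 \<ltimes> \<real>^2\<close> have positive diagonal: this is what
  makes the action on ellipses simply transitive (minus the identity matrix fixes
  the unit circle).\<close>

definition G :: "aff set" where
  "G = {(X, x). X$2$1 = 0 \<and> 0 < X$1$1 \<and> det X = 1}"

definition act :: "aff \<Rightarrow> (real^2) set \<Rightarrow> (real^2) set" where
  "act h E = (\<lambda>z. fst h *v z + snd h) ` E"

definition base_ellipse :: "(real^2) set" where
  "base_ellipse = ellipse (mat 1) 0"

text \<open>The identification of \<open>G\<close> with the manifold of ellipses.\<close>

definition orbit_map :: "aff \<Rightarrow> (real^2) set" where
  "orbit_map h = act h base_ellipse"

text \<open>A linear map whose restriction to \<open>G\<close> is a global chart. Being linear, it also
  gives the chart components of tangent vectors of \<open>G\<close>, in particular of elements of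
  the Lie algebra.\<close>

definition coords :: "aff \<Rightarrow> real^4" where
  "coords h = vector [fst h $ 1 $ 1, fst h $ 1 $ 2, snd h $ 1, snd h $ 2]"

definition group_of :: "(real^2) set \<Rightarrow> aff" where
  "group_of = inv_into G orbit_map"

definition ellipse_chart :: "(real^2) set \<Rightarrow> (real^4)" where
  "ellipse_chart p = coords (group_of p)"

text \<open>\<open>orbit_map\<close> is a bijection that turns left translation into \<open>act\<close>, and
  \<open>ellipse_chart\<close> is a global chart.\<close>

lemma vector_4:
  "(vector [a,b,c,d] :: 'a::zero^4) $ 1 = a" "(vector [a,b,c,d] :: 'a::zero^4) $ 2 = b"
  "(vector [a,b,c,d] :: 'a::zero^4) $ 3 = c" "(vector [a,b,c,d] :: 'a::zero^4) $ 4 = d"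
  unfolding vector_def by simp_all

lemma act_mult: "act (aff_mult h k) E = act h (act k E)"
  by (auto simp: act_def aff_mult_def image_image matrix_vector_mul_assoc matrix_vector_right_distrib add.assoc)

lemma orbit_map_mult: "orbit_map (aff_mult h k) = act h (orbit_map k)"
  by (simp add: orbit_map_def act_mult)

lemma G_iff: "h \<in> G \<longleftrightarrow> fst h $ 2 $ 1 = 0 \<and> 0 < fst h $ 1 $ 1 \<and> fst h $ 1 $ 1 * fst h $ 2 $ 2 = 1"
  by (cases h) (auto simp: G_def det_2)

lemma G_mult: "h \<in> G \<Longrightarrow> k \<in> G \<Longrightarrow> aff_mult h k \<in> G"
  by (simp add: G_iff aff_mult_def matrix_matrix_mult_def sum_2) algebra

lemma matrix_inv_sl2:
  fixes A :: "real^2^2" assumes "det A = 1"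
  shows "matrix_inv A = vector [vector [A$2$2, - A$1$2], vector [- A$2$1, A$1$1]]"
    (is "_ = ?B")
proof -
  have AB: "A ** ?B = mat 1"
    using assms by (simp add: det_2 vec_eq_iff forall_2 matrix_matrix_mult_def sum_2 mat_def algebra_simps)
  moreover have "?B ** A = mat 1"
    using assms by (simp add: det_2 vec_eq_iff forall_2 matrix_matrix_mult_def sum_2 mat_def algebra_simps)
  ultimately have "A ** matrix_inv A = mat 1 \<and> matrix_inv A ** A = mat 1"
    unfolding matrix_inv_def by (metis (mono_tags, lifting) someI_ex)
  then have inv: "matrix_inv A ** A = mat 1" ..
  have "matrix_inv A = matrix_inv A ** (A ** ?B)" by (simp only: AB matrix_mul_rid)
  also have "\<dots> = ?B" by (simp only: matrix_mul_assoc inv matrix_mul_lid)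
  finally show ?thesis .
qed

lemma ellipse_iff:
  assumes "det A = 1"
  shows "z \<in> ellipse A a \<longleftrightarrow>
    A$2$2 * (z$1 - a$1)^2 - (A$1$2 + A$2$1) * (z$1 - a$1) * (z$2 - a$2) + A$1$1 * (z$2 - a$2)^2 = 1"
  unfolding ellipse_def matrix_inv_sl2[OF assms]
  by (simp add: inner_vec_def matrix_vector_mult_def sum_2 algebra_simps power2_eq_square)

lemma base_iff: "z \<in> base_ellipse \<longleftrightarrow> (z$1)^2 + (z$2)^2 = 1"
  unfolding base_ellipse_def by (subst ellipse_iff) (simp_all, simp add: mat_def)

lemma orbit_iff:
  assumes "h \<in> G"
  shows "z \<in> orbit_map h \<longleftrightarrow>
    (fst h $ 2$2 * (z$1 - snd h $ 1) - fst h $ 1$2 * (z$2 - snd h $ 2))^2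
     + (fst h $ 1$1 * (z$2 - snd h $ 2))^2 = 1" (is "_ \<longleftrightarrow> ?c")
proof -
  obtain X x where h: "h = (X, x)" by force
  have X: "X$2$1 = 0" "X$1$1 * X$2$2 = 1" using assms by (auto simp: h G_iff)
  let ?w = "vector [X$2$2 * (z$1 - x$1) - X$1$2 * (z$2 - x$2), X$1$1 * (z$2 - x$2)] :: real^2"
  have w: "X *v ?w + x = z"
    using X by (simp add: vec_eq_iff forall_2 matrix_vector_mult_def sum_2) algebra
  have u: "v = ?w" if "X *v v + x = z" for v
  proof -
    have "X$1$1 * v$1 + X$1$2 * v$2 + x$1 = z$1" "X$2$2 * v$2 + x$2 = z$2"
      using that X(1) by (simp_all add: vec_eq_iff forall_2 matrix_vector_mult_def sum_2)
    then have z: "z$1 - x$1 = X$1$1 * v$1 + X$1$2 * v$2" "z$2 - x$2 = X$2$2 * v$2"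
      by simp_all
    have "v$1 = X$2$2 * (X$1$1 * v$1 + X$1$2 * v$2) - X$1$2 * (X$2$2 * v$2)"
      using X(2) by algebra
    moreover have "v$2 = X$1$1 * (X$2$2 * v$2)"
      using X(2) by algebra
    ultimately show ?thesis unfolding z by (simp add: vec_eq_iff forall_2)
  qed
  have "z \<in> orbit_map h \<longleftrightarrow> ?w \<in> base_ellipse"
  proof
    assume "z \<in> orbit_map h"
    then obtain v where "v \<in> base_ellipse" "X *v v + x = z"
      unfolding orbit_map_def act_def h by auto
    then show "?w \<in> base_ellipse" using u[of v] by simp
  next
    assume "?w \<in> base_ellipse"
    then have "X *v ?w + x \<in> orbit_map h" unfolding orbit_map_def act_def h by simp
    then show "z \<in> orbit_map h" by (simp only: w)
  qed
  then show ?thesis by (simp add: base_iff h)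
qed

lemma orbit_eq_ellipse:
  assumes "h \<in> G"
  shows "orbit_map h = ellipse (fst h ** transpose (fst h)) (snd h)"
    and "positive_definite (fst h ** transpose (fst h))" 
    and "det (fst h ** transpose (fst h)) = 1"
proof -
  have X: "fst h$2$1 = 0" "fst h$1$1 * fst h$2$2 = 1" "fst h$1$1>0" using assms by (auto simp: G_iff)
  show d: "det (fst h ** transpose (fst h)) = 1"
    using X by (simp only: det_mul det_transpose) (simp add: det_2)
  show "orbit_map h = ellipse (fst h ** transpose (fst h)) (snd h)"
  proof (intro set_eqI)
    fix z
    have *: "(d * p - b * q)^2 + (a * q)^2 = d*d * p^2 - (b*d + d*b) * p * q + (a*a + b*b) * q^2"
      for a b d p q :: real
      by algebra
    show "z \<in> orbit_map h \<longleftrightarrow> z \<in> ellipse (fst h ** transpose (fst h)) (snd h)"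
      unfolding orbit_iff[OF assms] ellipse_iff[OF d] *
      by (simp add: matrix_matrix_mult_def sum_2 transpose_def X(1))
  qed
  have "0 < z \<bullet> ((fst h ** transpose (fst h)) *v z)" if "z \<noteq> 0" for z
  proof -
    have "invertible (transpose (fst h))" using X by (simp only: invertible_det_nz det_transpose) (simp add: det_2)
    then have n: "transpose (fst h) *v z \<noteq> 0"
      using that matrix_left_invertible_ker[of "transpose (fst h)"] unfolding invertible_def by blast
    have "z \<bullet> ((fst h ** transpose (fst h)) *v z) = (transpose (fst h) *v z) \<bullet> (transpose (fst h) *v z)"
      by (simp add: matrix_vector_mul_assoc[symmetric] dot_lmul_matrix[symmetric])
    then show ?thesis using n by simp
  qed
  then show "positive_definite (fst h ** transpose (fst h))"
    by (simp add: positive_definite_def matrix_transpose_mul)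
qed

lemma orbit_map_surj: assumes "positive_definite A" "det A = 1"
  shows "ellipse A a \<in> orbit_map ` G"
proof -
  have "transpose A $ 1 $ 2 = A $ 1 $ 2" using assms(1) unfolding positive_definite_def by simp
  then have s: "A$2$1 = A$1$2" by (simp add: transpose_def)
  have "0 < axis 2 1 \<bullet> (A *v axis 2 1)" using assms(1) unfolding positive_definite_def
    by (simp del: axis_eq_axis)
  then have p: "0 < A$2$2" by (simp add: inner_vec_def matrix_vector_mult_def sum_2 axis_def)
  define c where "c = sqrt (A$2$2)"
  have c: "c > 0" "c^2 = A$2$2" using p by (auto simp: c_def)
  define X :: "real^2^2" where "X = vector [vector [1/c, A$1$2/c], vector [0, c]]"
  have G: "(X, a) \<in> G" using c by (simp add: G_iff X_def)
  have "A$1$1 * c^2 - A$1$2^2 = 1" using assms(2) s c by (simp add: det_2 power2_eq_square)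
  then have "A$1$1 = (1 + A$1$2^2) / c^2" using c(1) by (simp add: eq_divide_eq)
  moreover have "(1/c) * (1/c) + (A$1$2/c) * (A$1$2/c) = (1 + A$1$2^2) / c^2"
    "A$1$2/c * c = A$1$2" "c * (A$1$2/c) = A$1$2" "c * c = A$2$2"
    using c by (simp_all add: power2_eq_square add_divide_distrib)
  ultimately have "X ** transpose X = A"
    unfolding vec_eq_iff forall_2 X_def matrix_matrix_mult_def sum_2 transpose_def
    by (simp add: s)
  then have "ellipse A a = orbit_map (X, a)" using orbit_eq_ellipse(1)[OF G] by simp
  then show ?thesis using G by blast
qed

lemma orbit_map_inj: "inj_on orbit_map G"
proof (rule inj_onI)
  fix h k assume hk: "h \<in> G" "k \<in> G" "orbit_map h = orbit_map k"
  obtain a b d x y where h: "fst h$1$1 = a" "fst h$1$2 = b" "fst h$2$2 = d" "snd h$1 = x" "snd h$2 = y" by blast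
  obtain a' b' d' x' y' where k: "fst k$1$1 = a'" "fst k$1$2 = b'" "fst k$2$2 = d'" "snd k$1 = x'" "snd k$2 = y'" by blast
  have ad: "a > 0" "a' > 0" "a*d = 1" "a'*d' = 1" using hk h k by (auto simp: G_iff)
  have e: "(d * (u - x) - b * (v - y))^2 + (a * (v - y))^2 = 1 \<longleftrightarrow>
     (d' * (u - x') - b' * (v - y'))^2 + (a' * (v - y'))^2 = 1" for u v
  proof -
    have "(vector [u,v] :: real^2) \<in> orbit_map h \<longleftrightarrow> (vector [u,v] :: real^2) \<in> orbit_map k" using hk by simp
    then show ?thesis unfolding orbit_iff[OF hk(1)] orbit_iff[OF hk(2)] by (simp add: h k)
  qed
  have pt: "(d' * (a*p + b*q + x - x') - b' * (d*q + y - y'))^2 + (a' * (d*q + y - y'))^2 = 1"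
    if "p^2+q^2 = 1" for p q
  proof -
    have "d * (a*p+b*q) - b*(d*q) = p" "a*(d*q) = q" using ad(3) by algebra+
    then have "(d * (a*p + b*q + x - x) - b * (d*q + y - y))^2 + (a * (d*q + y - y))^2 = p^2 + q^2"
      by (simp only: add_diff_cancel_right')
    then show ?thesis using that by (simp only: e)
  qed
  define m n A B D where df: "m = d'*(x-x') - b'*(y-y')" "n = a'*(y-y')"
    "A = d'*a" "B = d'*b - b'*d" "D = a'*d"
  have q: "(A*p + B*q + m)^2 + (D*q + n)^2 = 1" if "p^2+q^2 = 1" for p q
  proof -
    have "A*p + B*q + m = d' * (a*p + b*q + x - x') - b' * (d*q + y - y')"
      "D*q + n = a' * (d*q + y - y')" by (simp_all add: df algebra_simps)
    then show ?thesis using pt[OF that] by (simp only:)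
  qed
  have d0: "d > 0" using ad(1,3) by (rule_tac zero_less_mult_pos[of a]) simp_all
  have d0': "d' > 0" using ad(2,4) by (rule_tac zero_less_mult_pos[of a']) simp_all
  have pos: "A > 0" "D > 0" using df ad d0 d0' by simp_all
  have 1: "(A+m)^2 + n^2 = 1" "(-A+m)^2 + n^2 = 1" "(B+m)^2+(D+n)^2 = 1" "(-B+m)^2+(-D+n)^2=1"
    using q[of 1 0] q[of "-1" 0] q[of 0 1] q[of 0 "-1"] by simp_all
  have "4 * A * m = 0" using 1(1,2) by algebra
  then have m: "m = 0" using pos by simp
  have "4 * D * n = 0" using 1(3,4) m by algebra
  then have n: "n = 0" using pos by simp
  have A: "A = 1" using 1(1) m n pos by (simp add: power2_eq_1_iff)
  have BD: "B^2 + D^2 = 1" using 1(3) m n by simp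
  have "A * D = (a * d) * (a' * d')" by (simp add: df)
  then have "A * D = 1" by (simp add: ad)
  then have D: "D = 1" using A by simp
  then have B: "B = 0" using BD by simp
  have y: "y = y'" using n df(2) ad(2) by simp
  then have x: "x = x'" using m df(1) d0' by simp
  have da: "d' * a = 1" "a' * d = 1" using A D df by simp_all
  have "a' * (d' * a) = a" "d' * (a' * d) = d" using ad(4) by algebra+
  then have aa: "a = a'" "d = d'" unfolding da by simp_all
  then have bb: "b = b'" using B df(4) d0 by simp
  have "fst h = fst k" "snd h = snd k"
    using x y aa bb h k hk(1,2) by (auto simp: vec_eq_iff forall_2 G_iff)
  then show "h = k" by (simp add: prod_eq_iff)
qed

lemma orbit_map_bij: "bij_betw orbit_map G ellipses"
  unfolding bij_betw_def
proof
  show "orbit_map ` G = ellipses"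
  proof
    show "orbit_map ` G \<subseteq> ellipses"
      unfolding ellipses_def using orbit_eq_ellipse by blast
    show "ellipses \<subseteq> orbit_map ` G"
      unfolding ellipses_def using orbit_map_surj by blast
  qed
qed (rule orbit_map_inj)

lemma group_of_orbit_map: "h \<in> G \<Longrightarrow> group_of (orbit_map h) = h"
  unfolding group_of_def using orbit_map_inj by simp

lemma ellipse_chart_orbit_map: "h \<in> G \<Longrightarrow> ellipse_chart (orbit_map h) = coords h"
  by (simp add: ellipse_chart_def group_of_orbit_map)

lemma global_chart_ellipses: "global_chart ellipses ellipse_chart"
  and ellipse_chart_image: "ellipse_chart ` ellipses = {q. 0 < q $ 1}"
proof -
  have im: "ellipse_chart ` ellipses = coords ` G"
    unfolding bij_betw_imp_surj_on[OF orbit_map_bij, symmetric] image_image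
    by (simp add: ellipse_chart_orbit_map)
  have inj: "inj_on coords G"
  proof (rule inj_onI)
    fix h k assume hk: "h \<in> G" "k \<in> G" and c: "coords h = coords k"
    from c have eq: "fst h$1$1 = fst k$1$1" "fst h$1$2 = fst k$1$2" "snd h = snd k"
      unfolding coords_def vec_eq_iff[where 'b=4] forall_4 vector_4 by (auto simp: vec_eq_iff forall_2)
    have "fst h$1$1 * fst h$2$2 = fst h$1$1 * fst k$2$2" "fst h$1$1 \<noteq> 0"
      using hk eq(1) by (simp_all add: G_iff)
    then have "fst h$2$2 = fst k$2$2" by simp
    then have "fst h = fst k"
      using hk eq by (simp add: G_iff vec_eq_iff forall_2)
    then show "h = k" using eq(3) by (simp add: prod_eq_iff)
  qed
  show im': "ellipse_chart ` ellipses = {q. 0 < q $ 1}"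
  proof -
    have "q \<in> coords ` G" if "0 < q$1" for q :: "real^4"
    proof -
      have "coords (vector [vector [q$1, q$2], vector [0, 1/q$1]], vector [q$3, q$4]) = q"
        by (simp add: coords_def vec_eq_iff forall_4 vector_4)
      moreover have "(vector [vector [q$1, q$2], vector [0, 1/q$1]], vector [q$3, q$4]) \<in> G"
        using that by (simp add: G_iff)
      ultimately show ?thesis by (metis image_eqI)
    qed
    then show ?thesis unfolding im by (auto simp: coords_def G_iff vector_4)
  qed
  have "inj_on ellipse_chart ellipses"
    unfolding bij_betw_imp_surj_on[OF orbit_map_bij, symmetric]
    using inj by (auto simp: inj_on_def ellipse_chart_orbit_map)
  moreover have "open {q :: real^4. 0 < q $ 1}"
    by (intro open_Collect_less continuous_intros)
  ultimately show "global_chart ellipses ellipse_chart" by (simp add: global_chart_def im')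
qed

text \<open>Under the identification of \<open>G\<close> with the manifold of ellipses, \<open>act h\<close> is left
  translation by \<open>h\<close>. This is its differential at the ellipse \<open>p\<close>.\<close>

definition translation_diff :: "aff \<Rightarrow> (real^2) set \<Rightarrow> (real^4) \<Rightarrow>\<^sub>L (real^4)" where
  "translation_diff h p = chart_diff ellipses ellipse_chart (act h) p"

definition left_invariant ::
    "((real^2) set \<Rightarrow> (real^4) gtan \<Rightarrow>\<^sub>L (real^4) gtan) \<Rightarrow> bool" where
  "left_invariant S \<longleftrightarrow>
     (\<forall>h\<in>G. \<forall>p\<in>ellipses. \<forall>w.
        S (act h p) (gtan_map (translation_diff h p) w)
          = gtan_map (translation_diff h p) (S p w))"


section \<open>Left invariant tensors\<close>

definition e1 :: aff where "e1 = (0, vector [1, 0])"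
definition e2 :: aff where "e2 = (0, vector [0, 1])"
definition e3 :: aff where "e3 = (vector [vector [1, 0], vector [0, -1]], 0)"
definition e4 :: aff where "e4 = (vector [vector [0, 2], vector [0, 0]], 0)"

text \<open>\<open>frame p c\<close> is the value at \<open>p\<close> of the left invariant vector field generated by
  \<open>c_1 e_1 + c_2 e_2 + c_3 e_3 + c_4 e_4\<close>.\<close>

definition frame :: "(real^2) set \<Rightarrow> (real^4) \<Rightarrow> real^4" where
  "frame p c = translation_diff (group_of p) base_ellipse
     (coords (c$1 *\<^sub>R e1 + c$2 *\<^sub>R e2 + c$3 *\<^sub>R e3 + c$4 *\<^sub>R e4))"

definition left_inv_endo :: "(real^4 \<Rightarrow> real^4) \<Rightarrow> (real^2) set \<Rightarrow> (real^4) \<Rightarrow>\<^sub>L (real^4)" where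
  "left_inv_endo A p = Blinfun (\<lambda>u. frame p (A (inv (frame p) u)))"

text \<open>The left invariant metric for which \<open>e_1, e_2, e_3, e_4\<close> are orthonormal.\<close>

definition ellipse_metric :: "(real^2) set \<Rightarrow> (real^4) \<Rightarrow>\<^sub>L (real^4) \<Rightarrow>\<^sub>L real" where
  "ellipse_metric p = Blinfun (\<lambda>u. Blinfun (\<lambda>v. inv (frame p) u \<bullet> inv (frame p) v))"

definition r_tensor :: "(real^2) set \<Rightarrow> (real^4) \<Rightarrow>\<^sub>L (real^4)" where
  "r_tensor = left_inv_endo (\<lambda>c. vector [c$1, c$2, - c$3, - c$4])"

text \<open>\<open>J e_1 = e_2\<close>, \<open>J e_3 = \<epsilon> e_4\<close>; hence \<open>J e_2 = - e_1\<close>, and \<open>J e_4 = - \<epsilon> e_3\<close> as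
  \<open>\<epsilon>\<^sup>2 = 1\<close>.\<close>

definition J_tensor :: "real \<Rightarrow> (real^2) set \<Rightarrow> (real^4) \<Rightarrow>\<^sub>L (real^4)" where
  "J_tensor \<epsilon> = left_inv_endo (\<lambda>c. vector [- c$2, c$1, - \<epsilon> * c$4, \<epsilon> * c$3])"

definition omega :: "real \<Rightarrow> (real^2) set \<Rightarrow> (real^4) \<Rightarrow>\<^sub>L (real^4) \<Rightarrow>\<^sub>L real" where
  "omega \<epsilon> p = ellipse_metric p o\<^sub>L J_tensor \<epsilon> p"

definition R_structure :: "(real^2) set \<Rightarrow> (real^4) gtan \<Rightarrow>\<^sub>L (real^4) gtan" where
  "R_structure p = Blinfun (\<lambda>w. (r_tensor p (fst w), - (snd w o\<^sub>L r_tensor p)))"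

definition Q_structure :: "real \<Rightarrow> (real^2) set \<Rightarrow> (real^4) gtan \<Rightarrow>\<^sub>L (real^4) gtan" where
  "Q_structure \<epsilon> p = antidiag (omega \<epsilon> p)"

definition Phi :: "real \<Rightarrow> real \<Rightarrow> (real^2) set \<Rightarrow> (real^4) gtan \<Rightarrow>\<^sub>L (real^4) gtan" where
  "Phi \<epsilon> t p = cos t *\<^sub>R R_structure p + sin t *\<^sub>R Q_structure \<epsilon> p"

end

(* The left invariant frame trivializes the generalized tangent bundle isometrically
   as the constant bundle with fibre R^4 x R^4, carrying the pairing <(x, y), (x', y')> = x.y' + y.x'.
   In this trivialization Phi is the constant operator
   (x, y) |-> (cos t r x - sin t J y, sin t J x - cos t r y), which gives left invariance and
   all the algebraic identities. For integrability, isotropy of an eigenbundle L turns the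
   pairing of a Courant bracket with y in L into the cyclic expression
   <D_u z, y> - <D_v w, y> + <D_x w, z>, where u, v, x are the vector parts of w, z, y.
   Derivatives of the trivialized sections stay in L and drop out, so only the derivative
   of the frame remains; in the cyclic sum it enters through its torsion, that is, the Lie
   bracket. What is left is the identity
   y.[u, v] + w.[v, x] + z.[x, u] = 0 (covector parts against vector parts) on the
   eigenspaces, a polynomial identity after parametrizing them by the half angle t/2. *)
theory Submission
  imports Defs
begin

section \<open>Smooth maps\<close>

text \<open>On an open set the values of a map determine its derivatives. This lets
  \<open>frechet_derivative\<close> be replaced by an explicit formula in
  \<open>Ck_on_SucI\<close>.\<close>

lemma Ck_on_cong:
  fixes f g :: "'a::real_normed_vector \<Rightarrow> 'b::real_normed_vector"
  assumes "open U" and "\<And>p. p \<in> U \<Longrightarrow> f p = g p"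
  shows "Ck_on k U f \<longleftrightarrow> Ck_on k U g"
  using assms(2)
proof (induction k arbitrary: f g)
  case 0
  then show ?case by (auto intro: continuous_on_cong)
next
  case (Suc k)
  have imp: "Ck_on (Suc k) U g'" if "Ck_on (Suc k) U f'" and eq: "\<And>p. p \<in> U \<Longrightarrow> f' p = g' p"
    for f' g' :: "'a \<Rightarrow> 'b"
  proof -
    have d: "f' differentiable at p" if "p \<in> U" for p
      using \<open>Ck_on (Suc k) U f'\<close> that assms(1) by (simp add: differentiable_on_eq_differentiable_at)
    have fd: "frechet_derivative f' (at p) = frechet_derivative g' (at p)" if "p \<in> U" for p
      using frechet_derivative_transform_within_open[OF d[OF that] assms(1) that] eq by auto
    have "g' differentiable at p" if "p \<in> U" for p
      using d[OF that] has_derivative_transform_within_open[OF _ assms(1) that] eq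
      unfolding differentiable_def by blast
    moreover have "Ck_on k U (\<lambda>p. frechet_derivative g' (at p) v)" for v
      using that Suc.IH[of "\<lambda>p. frechet_derivative f' (at p) v" "\<lambda>p. frechet_derivative g' (at p) v"] fd
      by simp
    ultimately show ?thesis
      using assms(1) by (simp add: differentiable_on_eq_differentiable_at)
  qed
  show ?case
    using imp[of f g] imp[of g f] Suc.prems by (metis)
qed

lemma Ck_on_SucI:
  assumes "open U" and "\<And>p. p \<in> U \<Longrightarrow> (f has_derivative f' p) (at p)"
    and "\<And>v. Ck_on k U (\<lambda>p. f' p v)"
  shows "Ck_on (Suc k) U f"
proof -
  have "f differentiable_on U"
    using assms(1,2) by (auto simp: differentiable_on_eq_differentiable_at differentiable_def)
  moreover have "Ck_on k U (\<lambda>p. frechet_derivative f (at p) v)" for v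
    using Ck_on_cong[OF assms(1), of "\<lambda>p. f' p v" "\<lambda>p. frechet_derivative f (at p) v" k]
      assms(3) frechet_derivative_at[OF assms(2)] by metis
  ultimately show ?thesis by simp
qed

lemma Ck_on_Suc_has_derivative:
  assumes "open U" "Ck_on (Suc k) U f" "p \<in> U"
  shows "(f has_derivative frechet_derivative f (at p)) (at p)"
  using assms by (simp add: differentiable_on_eq_differentiable_at frechet_derivative_works)

lemma Ck_on_SucD: "Ck_on (Suc k) U f \<Longrightarrow> Ck_on k U f"
proof (induction k arbitrary: f)
  case 0
  then show ?case by (simp add: differentiable_imp_continuous_on)
next
  case (Suc k)
  then show ?case by (metis Ck_on.simps(2))
qed

lemma Ck_on_const: "open U \<Longrightarrow> Ck_on k U (\<lambda>p. c)"
proof (induction k arbitrary: c)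
  case (Suc k)
  then show ?case by (intro Ck_on_SucI[where f' = "\<lambda>p v. 0"]) auto
qed simp

lemma Ck_on_bounded_linear:
  assumes "open U" "bounded_linear L" "Ck_on k U f"
  shows "Ck_on k U (\<lambda>p. L (f p))"
  using assms(3)
proof (induction k arbitrary: f)
  case 0
  then show ?case using bounded_linear.continuous_on[OF assms(2)] by auto
next
  case (Suc k)
  show ?case
  proof (rule Ck_on_SucI[OF assms(1), where f' = "\<lambda>p v. L (frechet_derivative f (at p) v)"])
    show "((\<lambda>p. L (f p)) has_derivative (\<lambda>v. L (frechet_derivative f (at p) v))) (at p)"
      if "p \<in> U" for p
      by (intro bounded_linear.has_derivative[OF assms(2)]
          Ck_on_Suc_has_derivative[OF assms(1) Suc.prems that])
    show "Ck_on k U (\<lambda>p. L (frechet_derivative f (at p) v))" for v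
      using Suc.prems by (intro Suc.IH) simp
  qed
qed

lemma Ck_on_linear_id: "open U \<Longrightarrow> Ck_on k U (\<lambda>p. p)"
proof (cases k)
  case (Suc n)
  assume "open U"
  then show ?thesis unfolding Suc
    by (intro Ck_on_SucI[where f' = "\<lambda>p v. v"]) (auto intro: Ck_on_const)
qed simp

lemma Ck_on_add:
  assumes "open U" "Ck_on k U f" "Ck_on k U g"
  shows "Ck_on k U (\<lambda>p. f p + g p)"
  using assms(2,3)
proof (induction k arbitrary: f g)
  case 0
  then show ?case by (auto intro: continuous_on_add)
next
  case (Suc k)
  let ?D = "\<lambda>f p. frechet_derivative f (at p)"
  show ?case
  proof (rule Ck_on_SucI[OF assms(1), where f' = "\<lambda>p v. ?D f p v + ?D g p v"])
    show "((\<lambda>p. f p + g p) has_derivative (\<lambda>v. ?D f p v + ?D g p v)) (at p)" if "p \<in> U" for p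
      using that Suc.prems assms(1) by (intro has_derivative_add Ck_on_Suc_has_derivative)
    show "Ck_on k U (\<lambda>p. ?D f p v + ?D g p v)" for v
      using Suc.prems by (intro Suc.IH) simp_all
  qed
qed

text \<open>Both terms of the product rule have the form \<open>B\<close> again, so the induction
  varies both arguments; \<open>Ck_on_SucD\<close> lowers the order of the factor left
  undifferentiated.\<close>

lemma Ck_on_bilinear:
  assumes "open U" "bounded_bilinear B" "Ck_on k U f" "Ck_on k U g"
  shows "Ck_on k U (\<lambda>p. B (f p) (g p))"
  using assms(3,4)
proof (induction k arbitrary: f g)
  case 0
  then show ?case using bounded_bilinear.continuous_on[OF assms(2)] by auto
next
  case (Suc k)
  let ?D = "\<lambda>f p. frechet_derivative f (at p)"
  show ?case
  proof (rule Ck_on_SucI[OF assms(1), where f' = "\<lambda>p v. B (f p) (?D g p v) + B (?D f p v) (g p)"])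
    show "((\<lambda>p. B (f p) (g p)) has_derivative (\<lambda>v. B (f p) (?D g p v) + B (?D f p v) (g p))) (at p)"
      if "p \<in> U" for p
      using that Suc.prems assms(1)
      by (intro bounded_bilinear.FDERIV[OF assms(2)] Ck_on_Suc_has_derivative)
    show "Ck_on k U (\<lambda>p. B (f p) (?D g p v) + B (?D f p v) (g p))" for v
      using Suc.prems Ck_on_SucD[OF Suc.prems(1)] Ck_on_SucD[OF Suc.prems(2)]
      by (intro Ck_on_add Suc.IH) (use assms(1) in auto)
  qed
qed

lemma Ck_on_inverse:
  fixes f :: "'a::real_normed_vector \<Rightarrow> real"
  assumes "open U" "Ck_on k U f" "\<And>p. p \<in> U \<Longrightarrow> f p \<noteq> 0"
  shows "Ck_on k U (\<lambda>p. inverse (f p))"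
  using assms(2,3)
proof (induction k)
  case 0
  then show ?case by (auto intro: continuous_on_inverse)
next
  case (Suc k)
  let ?D = "\<lambda>p. frechet_derivative f (at p)"
  \<comment> \<open>The derivative of 1/f contains 1/f itself, so the induction hypothesis is first
    applied to \<open>f\<close> at the lower order.\<close>
  have inv: "Ck_on k U (\<lambda>p. inverse (f p))"
    using Suc Ck_on_SucD by blast
  show ?case
  proof (rule Ck_on_SucI[OF assms(1), where f' = "\<lambda>p v. - (inverse (f p) * ?D p v * inverse (f p))"])
    show "((\<lambda>p. inverse (f p)) has_derivative (\<lambda>v. - (inverse (f p) * ?D p v * inverse (f p)))) (at p)"
      if "p \<in> U" for p
      using that Suc.prems assms(1)
      by (intro Deriv.has_derivative_inverse Ck_on_Suc_has_derivative)
    show "Ck_on k U (\<lambda>p. - (inverse (f p) * ?D p v * inverse (f p)))" for v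
      using Suc.prems inv
      by (intro Ck_on_bounded_linear[where L = uminus] Ck_on_bilinear[where B = "(*)"]
            bounded_linear_minus bounded_linear_ident bounded_bilinear_mult assms(1)) simp_all
  qed
qed

lemma smooth_on_cong:
  "open U \<Longrightarrow> (\<And>p. p \<in> U \<Longrightarrow> f p = g p) \<Longrightarrow> smooth_on U f \<longleftrightarrow> smooth_on U g"
  unfolding smooth_on_def using Ck_on_cong by metis

lemma smooth_on_const: "open U \<Longrightarrow> smooth_on U (\<lambda>p. c)"
  by (simp add: smooth_on_def Ck_on_const)

lemma smooth_on_add:
  "open U \<Longrightarrow> smooth_on U f \<Longrightarrow> smooth_on U g \<Longrightarrow> smooth_on U (\<lambda>p. f p + g p)"
  by (simp add: smooth_on_def Ck_on_add)

lemma smooth_on_bounded_linear: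
  "open U \<Longrightarrow> bounded_linear L \<Longrightarrow> smooth_on U f \<Longrightarrow> smooth_on U (\<lambda>p. L (f p))"
  by (simp add: smooth_on_def Ck_on_bounded_linear)

lemma smooth_on_linear: "open U \<Longrightarrow> bounded_linear L \<Longrightarrow> smooth_on U L"
  using smooth_on_bounded_linear[of U L "\<lambda>p. p"] by (simp add: smooth_on_def Ck_on_linear_id)

lemma smooth_on_bilinear:
  "open U \<Longrightarrow> bounded_bilinear B \<Longrightarrow> smooth_on U f \<Longrightarrow> smooth_on U g \<Longrightarrow>
    smooth_on U (\<lambda>p. B (f p) (g p))"
  by (simp add: smooth_on_def Ck_on_bilinear)

lemma smooth_on_inverse:
  fixes f :: "'a::real_normed_vector \<Rightarrow> real"
  shows "open U \<Longrightarrow> smooth_on U f \<Longrightarrow> (\<And>p. p \<in> U \<Longrightarrow> f p \<noteq> 0) \<Longrightarrow> smooth_on U (\<lambda>p. inverse (f p))"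
  by (simp add: smooth_on_def Ck_on_inverse)

lemma smooth_on_imp_has_derivative:
  assumes "open U" "smooth_on U f" "p \<in> U"
  shows "(f has_derivative blinfun_apply (fderiv f p)) (at p)"
proof -
  have *: "(f has_derivative frechet_derivative f (at p)) (at p)"
    using Ck_on_Suc_has_derivative[OF assms(1) _ assms(3), of 0 f] assms(2)
    unfolding smooth_on_def by blast
  then show ?thesis
    by (simp add: fderiv_def bounded_linear_Blinfun_apply has_derivative_bounded_linear)
qed

lemma fderiv_eqI:
  assumes "(f has_derivative f') (at p)"
  shows "blinfun_apply (fderiv f p) = f'"
  using frechet_derivative_at[OF assms] has_derivative_bounded_linear[OF assms]
  by (simp add: fderiv_def bounded_linear_Blinfun_apply)

section \<open>The left invariant frame in the chart\<close>

lemma has_derivative_vecI: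
  fixes f :: "'a::real_normed_vector \<Rightarrow> real^'n"
  assumes "\<And>i. ((\<lambda>x. f x $ i) has_derivative (\<lambda>v. f' v $ i)) (at p)"
  shows "(f has_derivative f') (at p)"
  using assms
  by (subst has_derivative_componentwise_within) (auto simp: Basis_vec_def inner_axis)

lemma vec4_eqI: "\<lbrakk>v$1 = w$1; v$2 = w$2; v$3 = w$3; v$4 = w$4\<rbrakk> \<Longrightarrow> v = (w::'a^4)"
  by (simp add: vec_eq_iff forall_4)

section \<open>The chart domain, the inverse chart and left translations in the chart\<close>

abbreviation chart_dom :: "(real^4) set" where "chart_dom \<equiv> {q. 0 < q $ 1}"

lemma open_chart_dom: "open chart_dom"
  by (intro open_Collect_less continuous_intros)

text \<open>The last matrix entry is forced by determinant one, so the four coordinates recover the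
  whole group element.\<close>

definition of_coords :: "real^4 \<Rightarrow> aff" where
  "of_coords q = (vector [vector [q$1, q$2], vector [0, 1/q$1]], vector [q$3, q$4])"

lemma of_coords_in_G: "q \<in> chart_dom \<Longrightarrow> of_coords q \<in> G"
  by (simp add: of_coords_def G_iff)

lemma coords_of_coords: "coords (of_coords q) = q"
  by (simp add: of_coords_def coords_def vec4_eqI vector_4)

definition ellipse_at :: "real^4 \<Rightarrow> (real^2) set" where
  "ellipse_at = inv_into ellipses ellipse_chart"

lemma ellipse_at_eq:
  assumes "q \<in> chart_dom" shows "ellipse_at q = orbit_map (of_coords q)"
proof -
  have "orbit_map (of_coords q) \<in> ellipses"
    using orbit_map_bij of_coords_in_G[OF assms] by (auto simp: bij_betw_def)
  moreover have "ellipse_chart (orbit_map (of_coords q)) = q"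
    using assms by (simp add: ellipse_chart_orbit_map of_coords_in_G coords_of_coords)
  ultimately show ?thesis
    using global_chart_ellipses unfolding ellipse_at_def global_chart_def by (metis inv_into_f_f)
qed

lemma ellipse_chart_ellipse_at: "q \<in> chart_dom \<Longrightarrow> ellipse_chart (ellipse_at q) = q"
  unfolding ellipse_at_def by (rule f_inv_into_f) (simp add: ellipse_chart_image)

lemma ellipse_at_ellipse_chart: "p \<in> ellipses \<Longrightarrow> ellipse_at (ellipse_chart p) = p"
  using global_chart_ellipses unfolding ellipse_at_def global_chart_def by (metis inv_into_f_f)

lemma ellipse_chart_in_dom: "p \<in> ellipses \<Longrightarrow> ellipse_chart p \<in> chart_dom"
  using ellipse_chart_image by blast

lemma group_of_ellipse_at: "q \<in> chart_dom \<Longrightarrow> group_of (ellipse_at q) = of_coords q"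
  by (simp add: ellipse_at_eq group_of_orbit_map of_coords_in_G)

lemma act_ellipse_at:
  assumes "h \<in> G" "q \<in> chart_dom"
  shows "ellipse_chart (act h (ellipse_at q)) = coords (aff_mult h (of_coords q))"
  using assms
  by (simp add: ellipse_at_eq orbit_map_mult[symmetric] ellipse_chart_orbit_map G_mult of_coords_in_G)

lemma act_in_ellipses: "h \<in> G \<Longrightarrow> p \<in> ellipses \<Longrightarrow> act h p \<in> ellipses"
  using orbit_map_bij G_mult orbit_map_mult unfolding bij_betw_def by (metis imageE imageI)

text \<open>The lower right entry of an element of \<open>G\<close> is 1/q_1, so left translation is
  affine in the coordinates except for b/q_1, with b the upper right entry of the matrix of
  \<open>h\<close>. This accounts for the term with (q_1)^2.\<close>

lemma translation_diff_ellipse_at: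
  assumes "h \<in> G" "q \<in> chart_dom"
  shows "translation_diff h (ellipse_at q) v =
    vector [fst h$1$1 * v$1, fst h$1$1 * v$2 - fst h$1$2 / (q$1)^2 * v$1,
            fst h$1$1 * v$3 + fst h$1$2 * v$4, fst h$2$2 * v$4]"
proof -
  define f where "f = (\<lambda>q. coords (aff_mult h (of_coords q)))"
  let ?D = "\<lambda>v. vector [fst h$1$1 * v$1, fst h$1$1 * v$2 - fst h$1$2 / (q$1)^2 * v$1,
            fst h$1$1 * v$3 + fst h$1$2 * v$4, fst h$2$2 * v$4] :: real^4"
  have f: "f q = vector [fst h$1$1 * q$1, fst h$1$1 * q$2 + fst h$1$2 * inverse (q$1),
      fst h$1$1 * q$3 + fst h$1$2 * q$4 + snd h$1, fst h$2$2 * q$4 + snd h$2]" for q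
    using assms(1)
    by (simp add: f_def coords_def aff_mult_def of_coords_def matrix_matrix_mult_def
        matrix_vector_mult_def sum_2 G_iff vector_4 vec4_eqI inverse_eq_divide)
  have "(f has_derivative ?D) (at q)"
  proof (rule has_derivative_vecI)
    have "\<forall>i. ((\<lambda>q. f q $ i) has_derivative (\<lambda>v. ?D v $ i)) (at q)"
      unfolding forall_4 f vector_4 using assms(2)
      by (auto intro!: derivative_eq_intros bounded_linear.has_derivative[OF bounded_linear_vec_nth]
          simp: power2_eq_square field_simps)
    then show "((\<lambda>q. f q $ i) has_derivative (\<lambda>v. ?D v $ i)) (at q)" for i ..
  qed
  then have D: "((ellipse_chart \<circ> act h \<circ> ellipse_at) has_derivative ?D) (at q)"
    by (rule has_derivative_transform_within_open[OF _ open_chart_dom])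
      (use assms in \<open>auto simp: f_def act_ellipse_at\<close>)
  show ?thesis
    unfolding translation_diff_def chart_diff_def ellipse_at_def[symmetric]
      ellipse_chart_ellipse_at[OF assms(2)] fderiv_eqI[OF D] ..
qed

text \<open>Written with constant operators and scalar coefficients, from which smoothness
  can be read off.\<close>

definition frame_map :: "real^4 \<Rightarrow> (real^4) \<Rightarrow>\<^sub>L (real^4)" where
  "frame_map q =
     q$1 *\<^sub>R Blinfun (\<lambda>c. vector [c$3, 2 * c$4, c$1, 0]) +
     q$2 *\<^sub>R Blinfun (\<lambda>c. vector [0, - c$3, c$2, 0]) +
     inverse (q$1) *\<^sub>R Blinfun (\<lambda>c. vector [0, 0, 0, c$2])"

definition coframe_map :: "real^4 \<Rightarrow> (real^4) \<Rightarrow>\<^sub>L (real^4)" where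
  "coframe_map q =
     inverse (q$1) *\<^sub>R Blinfun (\<lambda>v. vector [v$3, 0, v$1, v$2 / 2]) +
     (q$2 * (inverse (q$1) * inverse (q$1))) *\<^sub>R Blinfun (\<lambda>v. vector [0, 0, 0, v$1 / 2]) +
     q$2 *\<^sub>R Blinfun (\<lambda>v. vector [- v$4, 0, 0, 0]) +
     q$1 *\<^sub>R Blinfun (\<lambda>v. vector [0, v$4, 0, 0])"

lemma bounded_linear_vec4I:
  fixes f :: "real^4 \<Rightarrow> real^4"
  assumes "\<And>x y. f (x + y) = f x + f y" "\<And>r x. f (r *\<^sub>R x) = r *\<^sub>R f x"
  shows "bounded_linear f"
  using assms by (auto simp: linear_conv_bounded_linear[symmetric] intro: linearI)

lemma frame_map_apply:
  "frame_map q c = vector [q$1 * c$3, 2 * q$1 * c$4 - q$2 * c$3, q$1 * c$1 + q$2 * c$2, c$2 / q$1]"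
proof -
  have "bounded_linear (\<lambda>c::real^4. vector [c$3, 2 * c$4, c$1, 0] :: real^4)"
    "bounded_linear (\<lambda>c::real^4. vector [0, - c$3, c$2, 0] :: real^4)"
    "bounded_linear (\<lambda>c::real^4. vector [0, 0, 0, c$2] :: real^4)"
    by (intro bounded_linear_vec4I vec4_eqI; simp add: vector_4 algebra_simps)+
  then show ?thesis
    unfolding frame_map_def plus_blinfun.rep_eq scaleR_blinfun.rep_eq
    by (intro vec4_eqI) (simp_all add: bounded_linear_Blinfun_apply vector_4 inverse_eq_divide)
qed

lemma coframe_map_apply:
  "coframe_map q v = vector [v$3 / q$1 - q$2 * v$4, q$1 * v$4, v$1 / q$1,
     v$2 / (2 * q$1) + q$2 * v$1 / (2 * (q$1)^2)]"
proof -
  have "bounded_linear (\<lambda>v::real^4. vector [v$3, 0, v$1, v$2 / 2] :: real^4)"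
    "bounded_linear (\<lambda>v::real^4. vector [0, 0, 0, v$1 / 2] :: real^4)"
    "bounded_linear (\<lambda>v::real^4. vector [- v$4, 0, 0, 0] :: real^4)"
    "bounded_linear (\<lambda>v::real^4. vector [0, v$4, 0, 0] :: real^4)"
    by (intro bounded_linear_vec4I vec4_eqI; simp add: vector_4 algebra_simps add_divide_distrib)+
  then show ?thesis
    unfolding coframe_map_def plus_blinfun.rep_eq scaleR_blinfun.rep_eq
    by (intro vec4_eqI)
      (simp_all add: bounded_linear_Blinfun_apply vector_4 inverse_eq_divide power2_eq_square)
qed

lemma coframe_map_frame_map: "q \<in> chart_dom \<Longrightarrow> coframe_map q (frame_map q c) = c"
  by (intro vec4_eqI)
    (simp_all add: frame_map_apply coframe_map_apply vector_4 field_simps power2_eq_square)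

lemma frame_map_coframe_map: "q \<in> chart_dom \<Longrightarrow> frame_map q (coframe_map q v) = v"
  by (intro vec4_eqI)
    (simp_all add: frame_map_apply coframe_map_apply vector_4 field_simps power2_eq_square)

lemma frame_ellipse_at:
  assumes "q \<in> chart_dom"
  shows "frame (ellipse_at q) = frame_map q"
proof
  fix c
  \<comment> \<open>The coordinates of the identity of \<open>G\<close>, which corresponds to
    \<open>base_ellipse\<close>; the frame is the differential of left translation at this
    point.\<close>
  let ?o = "vector [1, 0, 0, 0] :: real^4"
  have o: "?o \<in> chart_dom" by (simp add: vector_4)
  have "of_coords ?o = (mat 1, 0)"
    by (simp add: of_coords_def vector_4 vec_eq_iff forall_2 mat_def)
  then have b: "base_ellipse = ellipse_at ?o"
    using o by (simp add: ellipse_at_eq orbit_map_def act_def)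
  show "frame (ellipse_at q) c = frame_map q c"
    unfolding frame_def group_of_ellipse_at[OF assms] b
      translation_diff_ellipse_at[OF of_coords_in_G[OF assms] o] frame_map_apply
    by (intro vec4_eqI)
      (simp_all add: of_coords_def coords_def e1_def e2_def e3_def e4_def vector_4)
qed

lemma inv_frame_ellipse_at: "q \<in> chart_dom \<Longrightarrow> inv (frame (ellipse_at q)) = coframe_map q"
  by (simp add: frame_ellipse_at coframe_map_frame_map frame_map_coframe_map inv_equality)

text \<open>The frame arises by translating the Lie algebra, so translation by \<open>h\<close>
  carries the frame at \<open>p\<close> to the frame at \<open>act h p\<close>. The proof checks
  this in coordinates.\<close>

lemma translation_diff_frame_map:
  assumes "h \<in> G" "p \<in> ellipses"
  shows "translation_diff h p (frame_map (ellipse_chart p) c) = frame_map (ellipse_chart (act h p)) c"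
proof -
  define q where "q = ellipse_chart p"
  have q: "q \<in> chart_dom" "p = ellipse_at q"
    using assms(2) by (simp_all add: q_def ellipse_chart_in_dom ellipse_at_ellipse_chart
        del: mem_Collect_eq)
  have "fst h $ 1 $ 1 \<noteq> 0" "fst h $ 2 $ 2 = inverse (fst h $ 1 $ 1)"
    using assms(1) by (auto simp: G_iff inverse_eq_divide field_simps)
  then show ?thesis
    unfolding q_def[symmetric] unfolding q(2) act_ellipse_at[OF assms(1) q(1)]
      translation_diff_ellipse_at[OF assms(1) q(1)] frame_map_apply
    using q(1) assms(1)
    by (intro vec4_eqI)
      (simp_all add: vector_4 coords_def aff_mult_def of_coords_def matrix_matrix_mult_def
        matrix_vector_mult_def sum_2 G_iff, simp_all add: field_simps power2_eq_square)
qed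

lemma smooth_on_frame_map: "smooth_on chart_dom frame_map"
  and smooth_on_coframe_map: "smooth_on chart_dom coframe_map"
  unfolding frame_map_def[abs_def] coframe_map_def[abs_def]
  by (intro smooth_on_add smooth_on_bilinear[OF _ bounded_bilinear_scaleR]
      smooth_on_bilinear[OF _ bounded_bilinear_mult] smooth_on_const smooth_on_inverse
      smooth_on_linear bounded_linear_vec_nth open_chart_dom; simp)+

section \<open>The Courant bracket of sections of an isotropic eigenbundle\<close>

lemma pairing_add: "pairing (w + w') z = pairing w z + pairing w' z"
  and pairing_diff: "pairing (w - w') z = pairing w z - pairing w' z"
  and pairing_add_right: "pairing w (z + z') = pairing w z + pairing w z'"
  and pairing_scaleR: "pairing (a *\<^sub>R w) z = a * pairing w z"
  and pairing_scaleR_right: "pairing w (a *\<^sub>R z) = a * pairing w z"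
  by (simp_all add: pairing_def blinfun.bilinear_simps algebra_simps)

lemma pairing_nondegenerate:
  assumes "\<And>z. pairing w z = 0" shows "w = 0"
proof -
  have "fst w = 0"
    using assms[of "(0, blinfun_inner_left (fst w))"] by (simp add: pairing_def blinfun_inner_left.rep_eq)
  moreover have "snd w = 0"
    using assms[of "(_, 0)"] by (intro blinfun_eqI) (simp add: pairing_def)
  ultimately show ?thesis by (simp add: prod_eq_iff)
qed

text \<open>Write w = u + \<sigma> and z = v + \<tau>. By isotropy \<tau>(u) = - \<sigma>(v), so
  subtracting half of d(\<tau>(u) - \<sigma>(v)) amounts to adding d(\<sigma>(v)). The part of it in
  which v is differentiated cancels against the Lie derivative along v.\<close>

lemma pairing_courant:
  fixes w z :: "'a::euclidean_space \<Rightarrow> 'a gtan"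
  assumes w: "(w has_derivative blinfun_apply W) (at p)"
    and z: "(z has_derivative blinfun_apply Z) (at p)"
    and U: "open U" "p \<in> U"
    and isotropic: "\<And>q. q \<in> U \<Longrightarrow> pairing (w q) (z q) = 0"
  shows "pairing (courant w z p) y =
    pairing (Z (fst (w p))) y - pairing (W (fst (z p))) y + pairing (W (fst y)) (z p)"
proof -
  have fst_d: "((\<lambda>q. fst (w q)) has_derivative (\<lambda>v. fst (W v))) (at p)"
    "((\<lambda>q. fst (z q)) has_derivative (\<lambda>v. fst (Z v))) (at p)"
    and snd_d: "((\<lambda>q. snd (w q)) has_derivative (\<lambda>v. snd (W v))) (at p)"
    "((\<lambda>q. snd (z q)) has_derivative (\<lambda>v. snd (Z v))) (at p)"
    using w z by (auto intro: has_derivative_fst has_derivative_snd)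
  note app = blinfun.FDERIV[OF snd_d(2) fst_d(1)] blinfun.FDERIV[OF snd_d(1) fst_d(2)]
  note eqs = fderiv_eqI[OF fst_d(1)] fderiv_eqI[OF fst_d(2)] fderiv_eqI[OF snd_d(1)]
    fderiv_eqI[OF snd_d(2)] fderiv_eqI[OF has_derivative_diff[OF app]]
  \<comment> \<open>Isotropy makes this function vanish near \<open>p\<close>; comparing its zero
    derivative with the product rule gives the relation that absorbs the exact term of the
    bracket.\<close>
  have "((\<lambda>q. pairing (w q) (z q)) has_derivative (\<lambda>v. 0)) (at p)"
    by (rule has_derivative_transform_within_open[OF has_derivative_const[of 0] U])
      (simp add: isotropic)
  from fun_cong[OF has_derivative_unique[OF this[unfolded pairing_def] has_derivative_add[OF app]]]
  have "0 = snd (z p) (fst (W v)) + snd (Z v) (fst (w p)) +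
      (snd (w p) (fst (Z v)) + snd (W v) (fst (z p)))" for v
    by simp
  from this[of "fst y"] show ?thesis
    by (simp add: pairing_def courant_def lie_bracket_def lie_deriv_def eqs
        blinfun.bilinear_simps algebra_simps)
qed

text \<open>The eigenspace is its own annihilator: y \<mapsto> l y + S y takes every vector into it,
  and skewness moves this map over to \<open>c\<close>, where it becomes l c - S c. Nondegeneracy of
  the pairing finishes.\<close>

lemma eigensection_courant:
  fixes S :: "'a::euclidean_space gtan \<Rightarrow>\<^sub>L 'a gtan"
  assumes "l * l = 1" and "S o\<^sub>L S = id_blinfun"
    and "\<And>w z. pairing (S w) z = - pairing w (S z)"
    and "\<And>y. S y = l *\<^sub>R y \<Longrightarrow> pairing c y = 0"
  shows "S c = l *\<^sub>R c"
proof -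
  have SS: "S (S y) = y" for y
    using assms(2) by (metis blinfun_apply_blinfun_compose blinfun_apply_id_blinfun)
  have "pairing (l *\<^sub>R c - S c) y = 0" for y
  proof -
    have "S (l *\<^sub>R y + S y) = l *\<^sub>R (l *\<^sub>R y + S y)"
      using assms(1) by (simp add: blinfun.bilinear_simps SS scaleR_add_right)
    then have "pairing c (l *\<^sub>R y + S y) = 0" by (rule assms(4))
    then show ?thesis
      using assms(3)[of c y]
      by (simp add: pairing_add_right pairing_diff pairing_scaleR pairing_scaleR_right)
  qed
  then have "l *\<^sub>R c - S c = 0" by (rule pairing_nondegenerate)
  then show ?thesis by simp
qed

section \<open>The structure on the Lie algebra\<close>

text \<open>The tensor r in frame coordinates; \<open>quarter_turn\<close> below is J in the same
  coordinates.\<close>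

definition reflect :: "real^4 \<Rightarrow> real^4" where
  "reflect c = vector [c$1, c$2, - c$3, - c$4]"

definition quarter_turn :: "real \<Rightarrow> real^4 \<Rightarrow> real^4" where
  "quarter_turn \<epsilon> c = vector [- c$2, c$1, - \<epsilon> * c$4, \<epsilon> * c$3]"

lemma bounded_linear_reflect: "bounded_linear reflect"
  and bounded_linear_quarter_turn: "bounded_linear (quarter_turn \<epsilon>)"
  by (intro bounded_linear_vec4I vec4_eqI; simp add: reflect_def quarter_turn_def vector_4 algebra_simps)+

lemma quarter_turn_twice: "\<epsilon> * \<epsilon> = 1 \<Longrightarrow> quarter_turn \<epsilon> (quarter_turn \<epsilon> c) = - c"
  by (intro vec4_eqI; simp add: quarter_turn_def vector_4 flip: mult.assoc)

text \<open>\<open>Phi\<close> in the left invariant frame, with covectors turned into vectors by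
  the metric. Then r* becomes r by symmetry, the flat of \<omega> becomes J, and its inverse becomes
  -J.\<close>

definition model :: "real \<Rightarrow> real \<Rightarrow> ((real^4) \<times> (real^4)) \<Rightarrow>\<^sub>L ((real^4) \<times> (real^4))" where
  "model \<epsilon> t = Blinfun (\<lambda>m.
     (cos t *\<^sub>R reflect (fst m) - sin t *\<^sub>R quarter_turn \<epsilon> (snd m),
      sin t *\<^sub>R quarter_turn \<epsilon> (fst m) - cos t *\<^sub>R reflect (snd m)))"

lemma model_apply:
  "model \<epsilon> t m = (cos t *\<^sub>R reflect (fst m) - sin t *\<^sub>R quarter_turn \<epsilon> (snd m),
                  sin t *\<^sub>R quarter_turn \<epsilon> (fst m) - cos t *\<^sub>R reflect (snd m))"
  unfolding model_def
  by (subst bounded_linear_Blinfun_apply)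
    (auto intro!: bounded_linear_Pair bounded_linear_sub
      bounded_linear_compose[OF bounded_linear_scaleR_right]
      bounded_linear_compose[OF bounded_linear_reflect]
      bounded_linear_compose[OF bounded_linear_quarter_turn] bounded_linear_fst bounded_linear_snd)

definition model_pairing :: "(real^4) \<times> (real^4) \<Rightarrow> (real^4) \<times> (real^4) \<Rightarrow> real" where
  "model_pairing m n = fst m \<bullet> snd n + snd m \<bullet> fst n"

text \<open>This combines the symmetry of r and the skew-symmetry of J for the inner
  product.\<close>

lemma model_pairing_skew: "model_pairing (model \<epsilon> t m) n = - model_pairing m (model \<epsilon> t n)"
  by (simp add: model_pairing_def model_apply reflect_def quarter_turn_def inner_vec_def sum_4 vector_4
      algebra_simps)

text \<open>The squares of r and J are 1 and -1, and r commutes with J, so the mixed terms in cos t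
  sin t cancel.\<close>

lemma model_model:
  assumes "\<epsilon> * \<epsilon> = 1" shows "model \<epsilon> t (model \<epsilon> t m) = m"
proof -
  have cs: "cos t * (cos t * x) + sin t * (sin t * x) = x" 
    "cos t * (cos t * x) + \<epsilon> * (\<epsilon> * (sin t * (sin t * x))) = x" for x
    using assms sin_cos_squared_add[of t] by algebra+
  show ?thesis
    by (intro prod_eqI vec4_eqI)
      (simp_all add: model_apply reflect_def quarter_turn_def vector_4 algebra_simps cs)
qed

text \<open>Skewness moves the eigenvalue from one argument to the other at the cost of a
  sign.\<close>

lemma model_eigenvectors_isotropic:
  assumes "l \<noteq> 0" "model \<epsilon> t m = l *\<^sub>R m" "model \<epsilon> t n = l *\<^sub>R n"
  shows "model_pairing m n = 0"
proof -
  have "l * model_pairing m n = - (l * model_pairing m n)"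
    using model_pairing_skew[of \<epsilon> t m n] assms(2,3) by (simp add: model_pairing_def algebra_simps)
  then show ?thesis using assms(1) by simp
qed

text \<open>The bracket of \<open>\<gg>\<close> in the basis \<open>e_1, e_2, e_3, e_4\<close>.\<close>

definition lie :: "real^4 \<Rightarrow> real^4 \<Rightarrow> real^4" where
  "lie x y = vector [2 * (x$4 * y$2 - x$2 * y$4) + (x$3 * y$1 - x$1 * y$3),
     x$2 * y$3 - x$3 * y$2, 0, 2 * (x$3 * y$4 - x$4 * y$3)]"

text \<open>For \<open>l = 1\<close> the hypotheses say \<open>(k, j) = \<plusminus>(cos (t/2), sin (t/2))\<close>; this
  covers the points where \<open>sin t = 0\<close> without a case distinction.\<close>

lemma model_eigenvector:
  assumes "model \<epsilon> t m = l *\<^sub>R m" "\<epsilon> * \<epsilon> = 1"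
    and k: "2 * k^2 = 1 + l * cos t" "2 * j^2 = 1 - l * cos t" "2 * k * j = l * sin t" "l * l = 1"
  obtains a b c d where "fst m = vector [k * a, k * b, j * c, j * d]"
    "snd m = vector [- j * b, j * a, - \<epsilon> * k * d, \<epsilon> * k * c]"
proof -
  obtain x y where m: "m = (x, y)" by force
  \<comment> \<open>The operator preserves the planes of the coordinate pairs (x_1, y_2), (x_2,
    y_1), (x_3, y_4), (x_4, y_3) and is a reflection on each.\<close>
  have e: "cos t * x$1 + sin t * y$2 = l * x$1" "cos t * x$2 - sin t * y$1 = l * x$2"
    "- cos t * x$3 + sin t * \<epsilon> * y$4 = l * x$3" "- cos t * x$4 - sin t * \<epsilon> * y$3 = l * x$4"
    "- sin t * x$2 - cos t * y$1 = l * y$1" "sin t * x$1 - cos t * y$2 = l * y$2"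
    "- sin t * \<epsilon> * x$4 + cos t * y$3 = l * y$3" "sin t * \<epsilon> * x$3 + cos t * y$4 = l * y$4"
    using assms(1)
    by (simp_all add: m model_apply reflect_def quarter_turn_def vec_eq_iff forall_4 vector_4 algebra_simps)
  show thesis
  proof
    \<comment> \<open>As k^2 + j^2 = 1, the unit eigenvectors in the four planes are (k, j), (k,
      -j), (j, \<epsilon> k), (j, -\<epsilon> k). The parameters are the inner products with
      them.\<close>
    show "fst m = vector [k * (k * x$1 + j * y$2), k * (k * x$2 - j * y$1),
        j * (j * x$3 + \<epsilon> * k * y$4), j * (j * x$4 - \<epsilon> * k * y$3)]"
      using e k assms(2) by (intro vec4_eqI; simp add: m vector_4; algebra)
    show "snd m = vector [- j * (k * x$2 - j * y$1), j * (k * x$1 + j * y$2),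
        - \<epsilon> * k * (j * x$4 - \<epsilon> * k * y$3), \<epsilon> * k * (j * x$3 + \<epsilon> * k * y$4)]"
      using e k assms(2) by (intro vec4_eqI; simp add: m vector_4; algebra)
  qed
qed

lemma model_eigenvectors_closed:
  assumes "\<epsilon> * \<epsilon> = 1" "l \<in> {1, -1}"
    and "model \<epsilon> t m = l *\<^sub>R m" "model \<epsilon> t n = l *\<^sub>R n" "model \<epsilon> t y = l *\<^sub>R y"
  shows "snd y \<bullet> lie (fst m) (fst n) + snd m \<bullet> lie (fst n) (fst y) + snd n \<bullet> lie (fst y) (fst m) = 0"
proof -
  obtain k j where k: "2 * k^2 = 1 + l * cos t" "2 * j^2 = 1 - l * cos t" "2 * k * j = l * sin t"
  proof (cases "l = 1")
    case True
    then show ?thesis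
      using that[of "cos (t/2)" "sin (t/2)"] cos_double_cos[of "t/2"] cos_double_sin[of "t/2"]
        sin_double[of "t/2"] by (simp add: mult.commute mult.left_commute)
  next
    case False
    then have "l = -1" using assms(2) by simp
    \<comment> \<open>The other eigenline of a reflection is orthogonal to the first, so the half
      angle moves by a quarter turn.\<close>
    then show ?thesis
      using that[of "- sin (t/2)" "cos (t/2)"] cos_double_cos[of "t/2"] cos_double_sin[of "t/2"]
        sin_double[of "t/2"] by (simp add: mult.commute mult.left_commute)
  qed
  have ll: "l * l = 1" using assms(2) by auto
  obtain a b c d where m: "fst m = vector [k * a, k * b, j * c, j * d]"
    "snd m = vector [- j * b, j * a, - \<epsilon> * k * d, \<epsilon> * k * c]"
    using model_eigenvector[OF assms(3,1) k ll] .
  obtain a' b' c' d' where n: "fst n = vector [k * a', k * b', j * c', j * d']"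
    "snd n = vector [- j * b', j * a', - \<epsilon> * k * d', \<epsilon> * k * c']"
    using model_eigenvector[OF assms(4,1) k ll] .
  obtain a'' b'' c'' d'' where y: "fst y = vector [k * a'', k * b'', j * c'', j * d'']"
    "snd y = vector [- j * b'', j * a'', - \<epsilon> * k * d'', \<epsilon> * k * c'']"
    using model_eigenvector[OF assms(5,1) k ll] .
  \<comment> \<open>Each summand is k j^2 times a trilinear form in the parameters, and these forms
    cancel in the cyclic sum.\<close>
  show ?thesis
    unfolding m n y lie_def inner_vec_def sum_4 vector_4 inner_real_def by algebra
qed

section \<open>The trivialization of the generalized tangent bundle\<close>

text \<open>The transpose of \<open>A\<close>, packaged as an operator that depends linearly on
  \<open>A\<close>, so that smoothness of the frame passes to its action on covectors.\<close>

definition pull :: "('a::real_normed_vector \<Rightarrow>\<^sub>L 'b::real_normed_vector) \<Rightarrow>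
    ('b \<Rightarrow>\<^sub>L real) \<Rightarrow>\<^sub>L ('a \<Rightarrow>\<^sub>L real)" where
  "pull A = Blinfun (\<lambda>\<sigma>. \<sigma> o\<^sub>L A)"

lemma pull_apply [simp]: "pull A \<sigma> = \<sigma> o\<^sub>L A"
  unfolding pull_def
  by (simp add: bounded_linear_Blinfun_apply
      bounded_bilinear.bounded_linear_left[OF bounded_bilinear_blinfun_compose])

lemma bounded_linear_pull: "bounded_linear pull"
  by (subst transfer_bounded_bilinear_bounded_linearI[of "\<lambda>A \<sigma>. \<sigma> o\<^sub>L A", symmetric])
    (auto intro!: ext
      intro: bounded_bilinear.flip[OF bounded_bilinear_blinfun_compose])

text \<open>The Riesz representative, inverse to \<open>blinfun_inner_left\<close>.\<close>

definition vec_of_form :: "('a::euclidean_space \<Rightarrow>\<^sub>L real) \<Rightarrow> 'a" where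
  "vec_of_form \<sigma> = (\<Sum>b\<in>Basis. \<sigma> b *\<^sub>R b)"

lemma bounded_linear_vec_of_form: "bounded_linear vec_of_form"
  unfolding vec_of_form_def[abs_def]
  by (intro bounded_linear_sum bounded_linear_compose[OF bounded_linear_scaleR_left]
      blinfun.bounded_linear_left)

lemma inner_vec_of_form: "v \<bullet> vec_of_form \<sigma> = \<sigma> v"
proof -
  have "\<sigma> v = \<sigma> (\<Sum>b\<in>Basis. (v \<bullet> b) *\<^sub>R b)"
    by (simp add: euclidean_representation)
  then show ?thesis
    by (simp add: vec_of_form_def inner_sum_right blinfun.sum_right blinfun.scaleR_right mult.commute)
qed

lemma blinfun_inner_left_vec_of_form: "blinfun_inner_left (vec_of_form \<sigma>) = \<sigma>"
  by (intro blinfun_eqI) (simp add: blinfun_inner_left.rep_eq inner_vec_of_form)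

lemma vec_of_form_blinfun_inner_left: "vec_of_form (blinfun_inner_left y) = y"
  by (simp add: vec_of_form_def blinfun_inner_left.rep_eq inner_commute[of _ y] euclidean_representation)

text \<open>The frame on vectors and the transpose of the coframe on covectors. Writing it with
  constant inclusions and projections reduces smoothness to that of the two maps.\<close>

definition triv :: "real^4 \<Rightarrow> ((real^4) \<times> (real^4)) \<Rightarrow>\<^sub>L (real^4) gtan" where
  "triv q = (Blinfun (\<lambda>x. (x, 0)) o\<^sub>L frame_map q o\<^sub>L fst_blinfun)
    + (Blinfun (\<lambda>\<sigma>. (0, \<sigma>)) o\<^sub>L pull (coframe_map q) o\<^sub>L Blinfun blinfun_inner_left o\<^sub>L snd_blinfun)"

definition untriv :: "real^4 \<Rightarrow> (real^4) gtan \<Rightarrow>\<^sub>L ((real^4) \<times> (real^4))" where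
  "untriv q = (Blinfun (\<lambda>x. (x, 0)) o\<^sub>L coframe_map q o\<^sub>L fst_blinfun)
    + (Blinfun (\<lambda>y. (0, y)) o\<^sub>L Blinfun vec_of_form o\<^sub>L pull (frame_map q) o\<^sub>L snd_blinfun)"

lemma Blinfun_inclusions:
  "blinfun_apply (Blinfun (\<lambda>x. (x, 0))) = (\<lambda>x. (x, 0))"
  "blinfun_apply (Blinfun (\<lambda>y. (0, y))) = (\<lambda>y. (0, y))"
  by (simp_all add: bounded_linear_Blinfun_apply bounded_linear_Pair)

lemma triv_apply:
  "triv q m = (frame_map q (fst m), blinfun_inner_left (snd m) o\<^sub>L coframe_map q)"
  by (simp add: triv_def plus_blinfun.rep_eq Blinfun_inclusions bounded_linear_Blinfun_apply
      bounded_linear_blinfun_inner_left)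

lemma untriv_apply:
  "untriv q w = (coframe_map q (fst w), vec_of_form (snd w o\<^sub>L frame_map q))"
  by (simp add: untriv_def plus_blinfun.rep_eq Blinfun_inclusions bounded_linear_Blinfun_apply
      bounded_linear_vec_of_form)

lemma triv_untriv: "q \<in> chart_dom \<Longrightarrow> triv q (untriv q w) = w"
  by (intro prod_eqI blinfun_eqI)
    (simp_all add: triv_apply untriv_apply frame_map_coframe_map blinfun_inner_left_vec_of_form)

lemma untriv_triv:
  assumes "q \<in> chart_dom" shows "untriv q (triv q m) = m"
proof -
  have "blinfun_inner_left y o\<^sub>L coframe_map q o\<^sub>L frame_map q = blinfun_inner_left y" for y
    using assms by (intro blinfun_eqI) (simp add: coframe_map_frame_map)
  then show ?thesis
    using assms
    by (simp add: triv_apply untriv_apply coframe_map_frame_map vec_of_form_blinfun_inner_left prod_eq_iff)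
qed

lemma smooth_on_triv: "smooth_on chart_dom triv"
  and smooth_on_untriv: "smooth_on chart_dom untriv"
  unfolding triv_def[abs_def] untriv_def[abs_def]
  by (intro smooth_on_add smooth_on_bilinear[OF _ bounded_bilinear_blinfun_compose] smooth_on_const
      smooth_on_bounded_linear[OF _ bounded_linear_pull] smooth_on_frame_map smooth_on_coframe_map
      open_chart_dom)+

text \<open>Two base points are kept apart so that one argument can be frozen at \<open>p\<close>
  while the other is differentiated in \<open>q\<close>.\<close>

lemma pairing_triv:
  "pairing (triv q m) (triv p n) =
    snd n \<bullet> coframe_map p (frame_map q (fst m)) + snd m \<bullet> coframe_map q (frame_map p (fst n))"
  by (simp add: pairing_def triv_apply blinfun_inner_left.rep_eq inner_commute)

lemma pairing_triv_same:
  "q \<in> chart_dom \<Longrightarrow> pairing (triv q m) (triv q n) = model_pairing m n"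
  by (simp add: pairing_triv coframe_map_frame_map model_pairing_def inner_commute)

section \<open>The metric, R, Q and Phi in the trivialization\<close>

lemma left_inv_endo_ellipse_at:
  assumes "bounded_linear A" "q \<in> chart_dom"
  shows "left_inv_endo A (ellipse_at q) u = frame_map q (A (coframe_map q u))"
  unfolding left_inv_endo_def inv_frame_ellipse_at[OF assms(2)]
  unfolding frame_ellipse_at[OF assms(2)]
  by (subst bounded_linear_Blinfun_apply)
    (auto intro!: bounded_linear_compose[OF blinfun.bounded_linear_right]
      bounded_linear_compose[OF assms(1)])

text \<open>As a composition of smooth operator fields the metric is visibly smooth.\<close>

lemma ellipse_metric_ellipse_at:
  assumes "q \<in> chart_dom"
  shows "ellipse_metric (ellipse_at q) =
    pull (coframe_map q) o\<^sub>L Blinfun blinfun_inner_left o\<^sub>L coframe_map q" (is "_ = ?g")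
proof -
  have "?g u v = coframe_map q u \<bullet> coframe_map q v" for u v
    by (simp add: bounded_linear_Blinfun_apply bounded_linear_blinfun_inner_left
        blinfun_inner_left.rep_eq inner_commute)
  then have "(\<lambda>v. coframe_map q u \<bullet> coframe_map q v) = ?g u" for u
    by auto
  then have "Blinfun (\<lambda>v. coframe_map q u \<bullet> coframe_map q v) = ?g u" for u
    by (simp only: blinfun_apply_inverse)
  then show ?thesis
    by (simp only: ellipse_metric_def inv_frame_ellipse_at[OF assms] blinfun_apply_inverse)
qed

lemma ellipse_metric_apply:
  "q \<in> chart_dom \<Longrightarrow> ellipse_metric (ellipse_at q) u v = coframe_map q u \<bullet> coframe_map q v"
  by (simp add: ellipse_metric_ellipse_at bounded_linear_Blinfun_apply
      bounded_linear_blinfun_inner_left blinfun_inner_left.rep_eq inner_commute)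

text \<open>\<open>A\<close> is the matrix of the form in the frame. The metric is the case of the
  identity, and \<omega> the case of J with inverse -J.\<close>

lemma antidiag_triv:
  fixes c :: "(real^4) \<Rightarrow>\<^sub>L (real^4) \<Rightarrow>\<^sub>L real"
  assumes q: "q \<in> chart_dom"
    and c: "\<And>u v. c u v = A (coframe_map q u) \<bullet> coframe_map q v"
    and inverse: "\<And>x. A (B x) = x" "\<And>x. B (A x) = x" and B: "bounded_linear B"
  shows "antidiag c (triv q m) = triv q (B (snd m), A (fst m))"
proof -
  have c': "c u = blinfun_inner_left (A (coframe_map q u)) o\<^sub>L coframe_map q" for u
    by (intro blinfun_eqI) (simp add: c blinfun_inner_left.rep_eq inner_commute)
  \<comment> \<open>The candidate for the inverse of \<open>c\<close>: express the covector in frame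
    coordinates, apply \<open>B\<close>, and return by the frame.\<close>
  let ?d = "\<lambda>\<sigma>. frame_map q (B (vec_of_form (pull (frame_map q) \<sigma>)))"
  have "?d (c u) = u" for u
    using untriv_triv[OF q, of "(0, A (coframe_map q u))"] q
    by (simp add: c' triv_apply untriv_apply inverse frame_map_coframe_map)
  moreover have "c (?d \<sigma>) = \<sigma>" for \<sigma>
    using triv_untriv[OF q, of "(0, \<sigma>)"] q
    by (simp add: c' triv_apply untriv_apply inverse coframe_map_frame_map)
  ultimately have inv: "inv (blinfun_apply c) = ?d"
    by (intro inv_equality)
  have d: "bounded_linear ?d"
    by (intro bounded_linear_compose[OF blinfun.bounded_linear_right]
        bounded_linear_compose[OF B] bounded_linear_compose[OF bounded_linear_vec_of_form]
        blinfun.bounded_linear_right)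
  have d_snd: "bounded_linear (\<lambda>w::(real^4) gtan. ?d (snd w))"
    by (rule bounded_linear_compose[OF d bounded_linear_snd])
  have "antidiag c w = (?d (snd w), c (fst w))" for w
    unfolding antidiag_def inv
    by (subst bounded_linear_Blinfun_apply)
      (auto intro!: bounded_linear_Pair d_snd[simplified]
        bounded_linear_compose[OF blinfun.bounded_linear_right] bounded_linear_fst)
  then show ?thesis
    using untriv_triv[OF q, of m] q
    by (simp add: c' triv_apply untriv_apply coframe_map_frame_map prod_eq_iff)
qed

lemma antidiag_ellipse_metric_triv:
  "q \<in> chart_dom \<Longrightarrow> antidiag (ellipse_metric (ellipse_at q)) (triv q m) = triv q (snd m, fst m)"
  using antidiag_triv[of q "ellipse_metric (ellipse_at q)" "\<lambda>x. x" "\<lambda>x. x" m]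
  by (simp add: ellipse_metric_apply)

lemma R_structure_triv:
  assumes q: "q \<in> chart_dom"
  shows "R_structure (ellipse_at q) (triv q m) = triv q (reflect (fst m), - reflect (snd m))"
proof -
  have r: "r_tensor (ellipse_at q) u = frame_map q (reflect (coframe_map q u))" for u
    using left_inv_endo_ellipse_at[OF bounded_linear_reflect q]
    by (simp add: r_tensor_def reflect_def[abs_def])
  have "R_structure p w = (r_tensor p (fst w), - (snd w o\<^sub>L r_tensor p))" for p w
    unfolding R_structure_def
    by (subst bounded_linear_Blinfun_apply)
      (auto intro!: bounded_linear_Pair bounded_linear_minus bounded_linear_fst bounded_linear_snd
        bounded_linear_compose[OF blinfun.bounded_linear_right]
        bounded_linear_compose[OF bounded_bilinear.bounded_linear_left[OF bounded_bilinear_blinfun_compose]])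
  \<comment> \<open>Symmetry of r turns its dual map on covectors into r itself.\<close>
  moreover have "reflect x \<bullet> y = x \<bullet> reflect y" for x y
    by (simp add: reflect_def inner_vec_def sum_4 vector_4)
  ultimately show ?thesis
    using q
    by (auto simp: triv_apply r coframe_map_frame_map blinfun_inner_left.rep_eq uminus_blinfun.rep_eq
        intro!: blinfun_eqI)
qed

lemma Q_structure_triv:
  assumes q: "q \<in> chart_dom" and \<epsilon>: "\<epsilon> * \<epsilon> = 1"
  shows "Q_structure \<epsilon> (ellipse_at q) (triv q m) =
    triv q (- quarter_turn \<epsilon> (snd m), quarter_turn \<epsilon> (fst m))"
proof -
  have "J_tensor \<epsilon> (ellipse_at q) u = frame_map q (quarter_turn \<epsilon> (coframe_map q u))" for u
    using left_inv_endo_ellipse_at[OF bounded_linear_quarter_turn q]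
    by (simp add: J_tensor_def quarter_turn_def[abs_def])
  then have "omega \<epsilon> (ellipse_at q) u v = quarter_turn \<epsilon> (coframe_map q u) \<bullet> coframe_map q v" for u v
    using q by (simp add: omega_def ellipse_metric_apply coframe_map_frame_map)
  moreover have "quarter_turn \<epsilon> (- quarter_turn \<epsilon> x) = x" "- quarter_turn \<epsilon> (quarter_turn \<epsilon> x) = x" for x
    using quarter_turn_twice[OF \<epsilon>, of x] bounded_linear.linear[OF bounded_linear_quarter_turn]
    by (simp_all add: linear_neg)
  ultimately show ?thesis
    unfolding Q_structure_def
    by (intro antidiag_triv[OF q] bounded_linear_minus bounded_linear_quarter_turn)
qed

lemma Phi_ellipse_at:
  assumes q: "q \<in> chart_dom" and \<epsilon>: "\<epsilon> * \<epsilon> = 1"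
  shows "Phi \<epsilon> t (ellipse_at q) = triv q o\<^sub>L model \<epsilon> t o\<^sub>L untriv q"
proof (rule blinfun_eqI)
  fix w
  define m where "m = untriv q w"
  have w: "w = triv q m" using q by (simp add: m_def triv_untriv del: mem_Collect_eq)
  have "Phi \<epsilon> t (ellipse_at q) w = cos t *\<^sub>R triv q (reflect (fst m), - reflect (snd m))
      + sin t *\<^sub>R triv q (- quarter_turn \<epsilon> (snd m), quarter_turn \<epsilon> (fst m))"
    using q \<epsilon> by (simp add: Phi_def plus_blinfun.rep_eq scaleR_blinfun.rep_eq w
        R_structure_triv Q_structure_triv del: mem_Collect_eq)
  also have "\<dots> = triv q (model \<epsilon> t m)"
    by (simp add: model_apply flip: blinfun.scaleR_right blinfun.add_right)
  finally show "Phi \<epsilon> t (ellipse_at q) w = (triv q o\<^sub>L model \<epsilon> t o\<^sub>L untriv q) w"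
    by (simp add: m_def)
qed

section \<open>Left invariance\<close>

lemma gtan_map_triv:
  assumes "h \<in> G" "p \<in> ellipses"
  shows "gtan_map (translation_diff h p) (triv (ellipse_chart p) m) = triv (ellipse_chart (act h p)) m"
proof -
  let ?q = "ellipse_chart p" and ?q' = "ellipse_chart (act h p)" and ?T = "translation_diff h p"
  have q: "?q \<in> chart_dom" "?q' \<in> chart_dom"
    using assms act_in_ellipses ellipse_chart_in_dom by blast+
  note T = translation_diff_frame_map[OF assms]
  \<comment> \<open>The inverse translation keeps frame coordinates too; on covectors this is what
    \<open>gtan_map\<close> asks for.\<close>
  have "inv (blinfun_apply ?T) = (\<lambda>v. frame_map ?q (coframe_map ?q' v))"
  proof (rule inv_equality)
    show "frame_map ?q (coframe_map ?q' (?T x)) = x" for x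
      using T[of "coframe_map ?q x"] q
      by (simp add: frame_map_coframe_map coframe_map_frame_map del: mem_Collect_eq)
    show "?T (frame_map ?q (coframe_map ?q' y)) = y" for y
      using q by (simp add: T frame_map_coframe_map del: mem_Collect_eq)
  qed
  moreover have "Blinfun (\<lambda>v. coframe_map ?q' v \<bullet> y) = blinfun_inner_left y o\<^sub>L coframe_map ?q'" for y
    by (metis (no_types, lifting) blinfun_apply_blinfun_compose blinfun_apply_inverse
        blinfun_inner_left.rep_eq ext)
  ultimately show ?thesis
    using q by (simp add: gtan_map_def triv_apply T blinfun_inner_left.rep_eq coframe_map_frame_map
        del: mem_Collect_eq)
qed

text \<open>Translations leave the coordinates in \<open>triv\<close> unchanged, and
  \<open>Phi\<close> acts on these by the same \<open>model\<close> at every point, so the two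
  commute.\<close>

lemma left_invariant_Phi:
  assumes "\<epsilon> * \<epsilon> = 1" shows "left_invariant (Phi \<epsilon> t)"
  unfolding left_invariant_def
proof (intro ballI allI)
  fix h p and w :: "(real^4) gtan" assume hp: "h \<in> G" "p \<in> ellipses"
  let ?q = "ellipse_chart p" and ?q' = "ellipse_chart (act h p)" and ?T = "translation_diff h p"
  have act: "act h p \<in> ellipses" using hp by (rule act_in_ellipses)
  have Phi: "Phi \<epsilon> t p' (triv (ellipse_chart p') m) = triv (ellipse_chart p') (model \<epsilon> t m)"
    if "p' \<in> ellipses" for p' m
    using Phi_ellipse_at[OF ellipse_chart_in_dom[OF that] assms, of t] that
    by (simp add: ellipse_at_ellipse_chart untriv_triv ellipse_chart_in_dom del: mem_Collect_eq)
  obtain m where w: "w = triv ?q m"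
    using triv_untriv[OF ellipse_chart_in_dom[OF hp(2)]] by metis
  show "Phi \<epsilon> t (act h p) (gtan_map ?T w) = gtan_map ?T (Phi \<epsilon> t p w)"
    by (simp add: w gtan_map_triv hp act Phi)
qed

section \<open>Integrability\<close>

text \<open>\<open>connection p k\<close> is the derivative of the frame in the direction \<open>frame_map p k\<close>,
  written in the frame.\<close>

definition connection :: "real^4 \<Rightarrow> real^4 \<Rightarrow> real^4 \<Rightarrow> real^4" where
  "connection p k x = vector [k$3 * x$1 + 2 * k$4 * x$2, - k$3 * x$2, k$3 * x$3,
     k$3 * x$4 - k$4 * x$3 + p$2 / p$1 * (k$3 * x$3)]"

text \<open>For left invariant fields D_X Y - D_Y X is their Lie bracket. The only term that depends
  on the point is symmetric in the two arguments and cancels.\<close>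

lemma connection_torsion: "connection p x y - connection p y x = lie x y"
  by (intro vec4_eqI) (simp_all add: connection_def lie_def vector_4 algebra_simps)

text \<open>Covectors are transported by the inverse of the frame, whose derivative has the opposite
  sign; hence the difference.\<close>

lemma has_derivative_pairing_triv:
  assumes "p \<in> chart_dom"
  shows "((\<lambda>q. pairing (triv q m) (triv p n)) has_derivative
    (\<lambda>v. snd n \<bullet> connection p (coframe_map p v) (fst m)
        - snd m \<bullet> connection p (coframe_map p v) (fst n))) (at p)"
proof -
  have p: "p$1 \<noteq> 0" using assms by simp
  show ?thesis
    unfolding pairing_triv inner_vec_def sum_4 frame_map_apply coframe_map_apply connection_def
      vector_4 inner_real_def
    by (rule has_derivative_eq_rhs,
        (rule derivative_intros bounded_linear.has_derivative[OF bounded_linear_vec_nth]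
          | simp add: p)+)
      (simp add: p fun_eq_iff field_simps power2_eq_square)
qed

lemma bounded_linear_pairing: "bounded_linear (\<lambda>w. pairing w z)"
  unfolding pairing_def
  by (intro bounded_linear_add bounded_linear_compose[OF blinfun.bounded_linear_right] bounded_linear_fst
      bounded_linear_compose[OF blinfun.bounded_linear_left bounded_linear_snd])

lemma model_untriv:
  assumes "q \<in> chart_dom" "(triv q o\<^sub>L model \<epsilon> t o\<^sub>L untriv q) w = l *\<^sub>R w"
  shows "model \<epsilon> t (untriv q w) = l *\<^sub>R untriv q w"
  using arg_cong[OF assms(2), of "untriv q"]
  by (simp add: untriv_triv[OF assms(1)] blinfun.scaleR_right)

lemma pairing_fderiv_eigensection:
  assumes p: "p \<in> chart_dom"
    and w: "eigensection chart_dom (\<lambda>q. triv q o\<^sub>L model \<epsilon> t o\<^sub>L untriv q) l w"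
    and n: "model \<epsilon> t n = l *\<^sub>R n" and l: "l \<noteq> 0"
  defines "m \<equiv> untriv p (w p)"
  shows "pairing (fderiv w p v) (triv p n) =
    snd n \<bullet> connection p (coframe_map p v) (fst m)
      - snd m \<bullet> connection p (coframe_map p v) (fst n)"
proof -
  define \<xi> where "\<xi> q = untriv q (w q)" for q
  have smooth: "smooth_on chart_dom w" using w by (simp add: eigensection_def)
  have w_eq: "w q = triv q (\<xi> q)" if "q \<in> chart_dom" for q
    using triv_untriv[OF that] by (simp add: \<xi>_def)
  have model: "model \<epsilon> t (\<xi> q) = l *\<^sub>R \<xi> q" if "q \<in> chart_dom" for q
    using w model_untriv[OF that] that by (simp add: eigensection_def \<xi>_def)
  have "smooth_on chart_dom \<xi>"
    unfolding \<xi>_def[abs_def]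
    by (rule smooth_on_bilinear[OF open_chart_dom bounded_bilinear_blinfun_apply smooth_on_untriv smooth])
  then have d\<xi>: "(\<xi> has_derivative fderiv \<xi> p) (at p)"
    by (rule smooth_on_imp_has_derivative[OF open_chart_dom _ p])
  have dtriv: "(triv has_derivative fderiv triv p) (at p)"
    by (rule smooth_on_imp_has_derivative[OF open_chart_dom smooth_on_triv p])
  have "(w has_derivative (\<lambda>v. triv p (fderiv \<xi> p v) + fderiv triv p v (\<xi> p))) (at p)"
    by (rule has_derivative_transform_within_open[OF blinfun.FDERIV[OF dtriv d\<xi>] open_chart_dom p])
      (simp add: w_eq)
  then have "fderiv w p v = triv p (fderiv \<xi> p v) + fderiv triv p v (\<xi> p)"
    by (simp add: fderiv_eqI)
  moreover have "pairing (triv p (fderiv \<xi> p v)) (triv p n) = 0"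
  proof -
    \<comment> \<open>As \<open>model\<close> is constant, differentiating the eigenvector equation
      shows that the derivative of \<xi> is again an eigenvector; isotropy then removes its pairing
      with \<open>n\<close>.\<close>
    have "((\<lambda>q. model \<epsilon> t (\<xi> q)) has_derivative (\<lambda>v. l *\<^sub>R fderiv \<xi> p v)) (at p)"
      by (rule has_derivative_transform_within_open[OF
          has_derivative_scaleR_right[OF d\<xi>] open_chart_dom p])
        (simp add: model)
    from fun_cong[OF has_derivative_unique[OF
        bounded_linear.has_derivative[OF blinfun.bounded_linear_right d\<xi>] this]]
    have "model \<epsilon> t (fderiv \<xi> p v) = l *\<^sub>R fderiv \<xi> p v" .
    then show ?thesis
      unfolding pairing_triv_same[OF p] using n l by (intro model_eigenvectors_isotropic)
  qed
  moreover have "pairing (fderiv triv p v (\<xi> p)) (triv p n) =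
      snd n \<bullet> connection p (coframe_map p v) (fst (\<xi> p))
      - snd (\<xi> p) \<bullet> connection p (coframe_map p v) (fst n)"
  proof -
    have "((\<lambda>q. pairing (triv q (\<xi> p)) (triv p n)) has_derivative
        (\<lambda>v. pairing (fderiv triv p v (\<xi> p)) (triv p n))) (at p)"
      by (intro bounded_linear.has_derivative[OF bounded_linear_pairing]
          bounded_linear.has_derivative[OF blinfun.bounded_linear_left dtriv])
    from fun_cong[OF has_derivative_unique[OF this has_derivative_pairing_triv[OF p]]]
    show ?thesis .
  qed
  ultimately show ?thesis
    by (simp add: pairing_add m_def \<xi>_def)
qed

lemma eigensection_courant_triv:
  assumes p: "p \<in> chart_dom" and \<epsilon>: "\<epsilon> * \<epsilon> = 1" and l: "l \<in> {1, -1}"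
    and w: "eigensection chart_dom (\<lambda>q. triv q o\<^sub>L model \<epsilon> t o\<^sub>L untriv q) l w"
    and z: "eigensection chart_dom (\<lambda>q. triv q o\<^sub>L model \<epsilon> t o\<^sub>L untriv q) l z"
    and y: "model \<epsilon> t y = l *\<^sub>R y"
  shows "pairing (courant w z p) (triv p y) = 0"
proof -
  have l0: "l \<noteq> 0" using l by auto
  define \<xi> where "\<xi> s q = untriv q (s q)" for s and q :: "real^4"
  have section_eq: "s q = triv q (\<xi> s q)" if "q \<in> chart_dom" for s q
    using triv_untriv[OF that] by (simp add: \<xi>_def)
  have model: "model \<epsilon> t (\<xi> s q) = l *\<^sub>R \<xi> s q"
    if s: "eigensection chart_dom (\<lambda>q. triv q o\<^sub>L model \<epsilon> t o\<^sub>L untriv q) l s" and q: "q \<in> chart_dom" for s q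
    using s model_untriv[OF q] q by (simp add: eigensection_def \<xi>_def)
  have "pairing (w q) (z q) = 0" if "q \<in> chart_dom" for q
    unfolding section_eq[OF that, of w] section_eq[OF that, of z] pairing_triv_same[OF that]
    using model_eigenvectors_isotropic[OF l0 model[OF w that] model[OF z that]] .
  moreover have "(w has_derivative fderiv w p) (at p)" "(z has_derivative fderiv z p) (at p)"
    using w z p by (auto simp: eigensection_def intro!: smooth_on_imp_has_derivative open_chart_dom)
  ultimately have "pairing (courant w z p) (triv p y) =
      pairing (fderiv z p (fst (w p))) (triv p y) - pairing (fderiv w p (fst (z p))) (triv p y)
      + pairing (fderiv w p (fst (triv p y))) (triv p (\<xi> z p))"
    using pairing_courant[of w "fderiv w p" p z "fderiv z p" chart_dom "triv p y"] open_chart_dom p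
      section_eq[OF p, of z]
    by (simp del: mem_Collect_eq)
  moreover have "coframe_map p (fst (s p)) = fst (\<xi> s p)" for s
    by (simp add: \<xi>_def untriv_apply)
  moreover have "coframe_map p (fst (triv p y)) = fst y"
    using p by (simp add: triv_apply coframe_map_frame_map)
  \<comment> \<open>Each of the three pairings contributes two connection terms of opposite sign.
    Collected by covector part, the six terms form three torsions.\<close>
  ultimately have "pairing (courant w z p) (triv p y) =
      snd y \<bullet> (connection p (fst (\<xi> w p)) (fst (\<xi> z p)) - connection p (fst (\<xi> z p)) (fst (\<xi> w p)))
      + snd (\<xi> w p) \<bullet> (connection p (fst (\<xi> z p)) (fst y) - connection p (fst y) (fst (\<xi> z p)))
      + snd (\<xi> z p) \<bullet> (connection p (fst y) (fst (\<xi> w p)) - connection p (fst (\<xi> w p)) (fst y))"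
    by (simp add: pairing_fderiv_eigensection[OF p w y l0] pairing_fderiv_eigensection[OF p z y l0]
        pairing_fderiv_eigensection[OF p w model[OF z p] l0] inner_diff_right flip: \<xi>_def)
  then show ?thesis
    unfolding connection_torsion
    using model_eigenvectors_closed[OF \<epsilon> l model[OF w p] model[OF z p] y] by simp
qed

text \<open>Only the diagonal blocks enter the trace. They are cos t r and its negative dual, whose
  diagonal entries cancel basis vector by basis vector.\<close>

lemma gtrace_triv:
  "gtrace (triv q o\<^sub>L model \<epsilon> t o\<^sub>L untriv q) = 0"
proof -
  have "reflect x \<bullet> y = x \<bullet> reflect y" for x y
    by (simp add: reflect_def inner_vec_def sum_4 vector_4)
  have reflect_0: "reflect 0 = 0" "quarter_turn \<epsilon> 0 = 0"
    by (simp_all add: linear_0 bounded_linear.linear bounded_linear_reflect bounded_linear_quarter_turn)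
  have vec_0: "vec_of_form 0 = 0"
    by (simp add: vec_of_form_def)
  have "vec_of_form (blinfun_inner_left i o\<^sub>L frame_map q) \<bullet> reflect (coframe_map q i)
     = frame_map q (reflect (coframe_map q i)) \<bullet> i" for i
    by (simp add: inner_commute[of "vec_of_form _"] inner_vec_of_form blinfun_inner_left.rep_eq)
  then have "coframe_map q i \<bullet> reflect (vec_of_form (blinfun_inner_left i o\<^sub>L frame_map q))
     = frame_map q (reflect (coframe_map q i)) \<bullet> i" for i
    using \<open>\<And>y x. reflect x \<bullet> y = x \<bullet> reflect y\<close> by (metis inner_commute)
  then show ?thesis
    by (simp add: gtrace_def triv_apply untriv_apply model_apply reflect_0 vec_0
        blinfun_inner_left.rep_eq blinfun.scaleR_right inner_diff_right flip: sum.distrib)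
qed

lemma gen_paracomplex_on_triv:
  assumes \<epsilon>: "\<epsilon> * \<epsilon> = 1"
  shows "gen_paracomplex_on chart_dom (\<lambda>q. triv q o\<^sub>L model \<epsilon> t o\<^sub>L untriv q)"
    (is "gen_paracomplex_on _ ?S")
proof -
  have involution: "?S p o\<^sub>L ?S p = id_blinfun" if p: "p \<in> chart_dom" for p
    by (intro blinfun_eqI) (simp add: untriv_triv[OF p] triv_untriv[OF p] model_model \<epsilon>)
  have skew: "pairing (?S p w) z = - pairing w (?S p z)" if p: "p \<in> chart_dom" for p w z
  proof -
    have "pairing (triv p (model \<epsilon> t m)) (triv p n) = - pairing (triv p m) (triv p (model \<epsilon> t n))" for m n
      by (simp only: pairing_triv_same[OF p] model_pairing_skew)
    from this[of "untriv p w" "untriv p z"] show ?thesis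
      by (simp add: triv_untriv[OF p])
  qed
  have closed: "?S p (courant w z p) = l *\<^sub>R courant w z p"
    if l: "l \<in> {1, -1}" and wz: "eigensection chart_dom ?S l w" "eigensection chart_dom ?S l z"
      and p: "p \<in> chart_dom" for l w z p
  proof (rule eigensection_courant[OF _ involution[OF p] skew[OF p]])
    show "l * l = 1" using l by auto
    \<comment> \<open>The test vector \<open>y\<close> is rewritten as the trivialization of a
      constant eigenvector of \<open>model\<close>.\<close>
    fix y assume y: "?S p y = l *\<^sub>R y"
    show "pairing (courant w z p) y = 0"
      using model_untriv[OF p y] eigensection_courant_triv[OF p \<epsilon> l wz] triv_untriv[OF p, of y] by metis
  qed
  have "smooth_on chart_dom ?S"
    by (intro smooth_on_bilinear[OF _ bounded_bilinear_blinfun_compose] smooth_on_const smooth_on_triv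
        smooth_on_untriv open_chart_dom)
  then show ?thesis
    unfolding gen_paracomplex_on_def using involution skew closed gtrace_triv by blast
qed

lemma gen_paracomplex_on_cong:
  assumes "open U" and eq: "\<And>p. p \<in> U \<Longrightarrow> S p = S' p"
  shows "gen_paracomplex_on U S \<longleftrightarrow> gen_paracomplex_on U S'"
proof -
  have "eigensection U S = eigensection U S'"
    by (simp add: eigensection_def fun_eq_iff eq)
  then show ?thesis
    unfolding gen_paracomplex_on_def using smooth_on_cong[OF assms] eq by simp
qed

lemma pseudo_riemannian_on_ellipse_metric:
  "pseudo_riemannian_on chart_dom (\<lambda>q. ellipse_metric (ellipse_at q))"
proof -
  have "smooth_on chart_dom (\<lambda>q. pull (coframe_map q) o\<^sub>L Blinfun blinfun_inner_left o\<^sub>L coframe_map q)"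
    by (intro smooth_on_bilinear[OF _ bounded_bilinear_blinfun_compose] smooth_on_const
        smooth_on_bounded_linear[OF _ bounded_linear_pull] smooth_on_coframe_map open_chart_dom)
  then have "smooth_on chart_dom (\<lambda>q. ellipse_metric (ellipse_at q))"
    by (subst smooth_on_cong[OF open_chart_dom ellipse_metric_ellipse_at])
  moreover have "u = 0" if q: "q \<in> chart_dom" and "\<forall>v. ellipse_metric (ellipse_at q) u v = 0" for q u
  proof -
    have "coframe_map q u = 0"
      using that(2) ellipse_metric_apply[OF q, of u u] by simp
    then show ?thesis using frame_map_coframe_map[OF q, of u] by simp
  qed
  ultimately show ?thesis
    unfolding pseudo_riemannian_on_def by (simp add: ellipse_metric_apply inner_commute del: mem_Collect_eq)
qed

theorem proposition5p2:
  fixes \<epsilon> t :: real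
  assumes "\<epsilon> \<in> {1, -1}"
  shows "left_invariant (Phi \<epsilon> t) \<and>
         integrable_one_minus_one_structure ellipses ellipse_chart ellipse_metric (Phi \<epsilon> t)"
proof
  have \<epsilon>: "\<epsilon> * \<epsilon> = 1" using assms by auto
  then show "left_invariant (Phi \<epsilon> t)" by (rule left_invariant_Phi)
  have "gen_paracomplex_on chart_dom (\<lambda>q. Phi \<epsilon> t (ellipse_at q))"
    using gen_paracomplex_on_triv[OF \<epsilon>]
    by (subst gen_paracomplex_on_cong[OF open_chart_dom Phi_ellipse_at[OF _ \<epsilon>]])
  moreover have "Phi \<epsilon> t (ellipse_at q) o\<^sub>L antidiag (ellipse_metric (ellipse_at q)) =
      - (antidiag (ellipse_metric (ellipse_at q)) o\<^sub>L Phi \<epsilon> t (ellipse_at q))" (is "?l = ?r")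
    if q: "q \<in> chart_dom" for q
  proof (rule blinfun_eqI)
    fix w
    obtain m where w: "w = triv q m" using triv_untriv[OF q] by metis
    \<comment> \<open>In the trivialization the metric structure swaps the two components, and
      conjugating \<open>model\<close> by this swap changes its sign.\<close>
    show "?l w = ?r w"
      by (simp add: w Phi_ellipse_at[OF q \<epsilon>] antidiag_ellipse_metric_triv[OF q] untriv_triv[OF q]
          uminus_blinfun.rep_eq model_apply flip: blinfun.minus_right)
  qed
  ultimately have "one_minus_one_structure_on chart_dom (\<lambda>q. ellipse_metric (ellipse_at q))
      (\<lambda>q. Phi \<epsilon> t (ellipse_at q))"
    unfolding one_minus_one_structure_on_def using pseudo_riemannian_on_ellipse_metric by blast
  then show "integrable_one_minus_one_structure ellipses ellipse_chart ellipse_metric (Phi \<epsilon> t)"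
    by (simp add: integrable_one_minus_one_structure_def global_chart_ellipses ellipse_chart_image
        comp_def ellipse_at_def)
qed

end
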